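(* Let $n\ge 1$. Let $\mathfrak{Q}_n^{multi}(n)\subset\mathfrak{Q}_n(n)$ be the vector space over $\mathbb{C}$ defined in the context. (1) The dimension of $\mathfrak{Q}_n^{multi}(n)$ is equal to the number of parking functions of length $n$, that is, $\dim\mathfrak{Q}_n^{multi}(n)=(n+1)^{n-1}$. (2) Moreover, $\mathfrak{Q}_n^{multi}(n)$, equipped with the natural action of the symmetric group $S_n$ permuting the colours, is isomorphic, as a representation of $S_n$, to the parking functions module $\mathrm{PF}(n)$.
   Context: All vector spaces and algebras are over $\mathbb{C}$; algebras are unital and associative; modules are right modules. For $k\ge1$, $\mathfrak{B}(k)$ is the associative algebra with generators $e_p[i]$ ($p=1,\dots,k$, $i\in\mathbb{Z}$) and relations $\{e_p[i],e_q[j]\}=\{e_p[i+1],e_q[j-1]\}$ for all $i,j\in\mathbb{Z}$ and all $p,q\in\{1,\dots,k\}$, where $\{a,b\}=ab+ba$. The subscript $p$ of $e_p[i]$ is called its colour. Let $\mathfrak{B}_+(k)$ be the subalgebra generated by all $e_p[i]$ with $i>0$, and let $\mathfrak{N}=\mathbb{C}v\otimes_{\mathfrak{B}_+(k)}\mathfrak{B}(k)$ be the right $\mathfrak{B}(k)$-module induced from the trivial one-dimensional right $\mathfrak{B}_+(k)$-module $\mathbb{C}v$, where $v e_p[i]=0$ for all $p$ and all $i>0$. Let $\mathfrak{B}_{\ge0}(k)$ be the linear span of the $e_p[i]$ with $1\le p\le k$, $i\ge0$. For $n\ge 1$, $\mathfrak{Q}_n(k)\subset\mathfrak{N}$ is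 the image of the linear map $\mathfrak{B}_{\ge0}(k)^{\otimes n}\to\mathfrak{N}$, $e_{p_1}[i_1]\otimes\cdots\otimes e_{p_n}[i_n]\mapsto v e_{p_1}[i_1]\cdots e_{p_n}[i_n]$, i.e. the span of all vectors $v e_{p_1}[i_1]\cdots e_{p_n}[i_n]$ with all $i_s\ge0$. For $k=n$, $\mathfrak{Q}_n^{multi}(n)$ is the subspace of $\mathfrak{Q}_n(n)$ spanned by all such monomials $v e_{p_1}[i_1]\cdots e_{p_n}[i_n]$ (with all $i_s\ge0$) in which each colour $1,\dots,n$ occurs exactly once. The group $S_n$ acts by permuting colours: $\sigma(v e_{p_1}[i_1]\cdots e_{p_n}[i_n])=v e_{\sigma(p_1)}[i_1]\cdots e_{\sigma(p_n)}[i_n]$. A parking function of length $n$ is a map $f\colon\{1,\dots,n\}\to\{1,\dots,n\}$ such that $\#f^{-1}(\{1,\dots,j\})\ge j$ for each $j=1,\dots,n$. The group $S_n$ acts on the set of parking functions of length $n$ by permuting the arguments, and $\mathrm{PF}(n)$ is the corresponding permutation representation over $\mathbb{C}$ (with basis the set of parking functions). *)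

theory Defs
  imports Complex_Main "HOL-Library.Poly_Mapping" "HOL-Library.Cardinality"
begin

section \<open>Finitely supported functions as free vector spaces\<close>

text \<open>The type \<open>'a \<Rightarrow>\<^sub>0 complex\<close> is the complex vector space with basis \<open>'a\<close>.\<close>

definition scale_pm :: "complex \<Rightarrow> ('a \<Rightarrow>\<^sub>0 complex) \<Rightarrow> ('a \<Rightarrow>\<^sub>0 complex)" where
  "scale_pm c f = Poly_Mapping.map ((*) c) f"

abbreviation pt :: "'a \<Rightarrow> ('a \<Rightarrow>\<^sub>0 complex)" where
  "pt a \<equiv> Poly_Mapping.single a 1"

definition push_pm :: "('a \<Rightarrow> 'b) \<Rightarrow> ('a \<Rightarrow>\<^sub>0 complex) \<Rightarrow> ('b \<Rightarrow>\<^sub>0 complex)" where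
  "push_pm g f = (\<Sum>k\<in>Poly_Mapping.keys f. Poly_Mapping.single (g k) (Poly_Mapping.lookup f k))"

lemma lookup_scale_pm [simp]:
  "Poly_Mapping.lookup (scale_pm c f) k = c * Poly_Mapping.lookup f k"
  unfolding scale_pm_def by transfer (simp add: when_def)

lemma scale_pm_single [simp]: "scale_pm c (Poly_Mapping.single a d) = Poly_Mapping.single a (c * d)"
  by (rule poly_mapping_eqI) (simp add: lookup_single when_def)

interpretation pm: vector_space "scale_pm :: complex \<Rightarrow> ('a \<Rightarrow>\<^sub>0 complex) \<Rightarrow> ('a \<Rightarrow>\<^sub>0 complex)"
  by unfold_locales (auto intro!: poly_mapping_eqI simp: lookup_add algebra_simps)

lemma push_pm_superset:
  assumes "finite K" "Poly_Mapping.keys f \<subseteq> K"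
  shows "push_pm g f = (\<Sum>k\<in>K. Poly_Mapping.single (g k) (Poly_Mapping.lookup f k))"
  unfolding push_pm_def using assms
  by (intro sum.mono_neutral_left) (auto simp: in_keys_iff)

lemma push_pm_add: "push_pm g (f + h) = push_pm g f + push_pm g h"
proof -
  let ?K = "Poly_Mapping.keys f \<union> Poly_Mapping.keys h"
  have "Poly_Mapping.keys (f + h) \<subseteq> ?K" by (rule keys_add)
  then show ?thesis
    by (simp add: push_pm_superset[of ?K] lookup_add single_add sum.distrib)
qed

lemma push_pm_zero [simp]: "push_pm g 0 = 0"
  by (simp add: push_pm_def)

lemma push_pm_uminus: "push_pm g (- f) = - push_pm g f"
  using push_pm_add[of g f "- f"] by (simp add: eq_neg_iff_add_eq_0 add.commute)

lemma push_pm_diff: "push_pm g (f - h) = push_pm g f - push_pm g h"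
  using push_pm_add[of g f "- h"] by (simp add: push_pm_uminus)

lemma push_pm_single [simp]:
  "push_pm g (Poly_Mapping.single a c) = Poly_Mapping.single (g a) c"
  by (cases "c = 0") (simp_all add: push_pm_def)

lemma scale_pm_sum: "scale_pm c (sum f A) = (\<Sum>a\<in>A. scale_pm c (f a))"
  by (induction A rule: infinite_finite_induct) (simp_all add: pm.scale_right_distrib)

lemma push_pm_scale: "push_pm g (scale_pm c f) = scale_pm c (push_pm g f)"
proof -
  have "Poly_Mapping.keys (scale_pm c f) \<subseteq> Poly_Mapping.keys f"
    by (auto simp: in_keys_iff)
  then show ?thesis
    by (simp add: push_pm_superset[of "Poly_Mapping.keys f"] scale_pm_sum)
qed

lemma push_pm_linear: "Vector_Spaces.linear scale_pm scale_pm (push_pm g)"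
  by unfold_locales (simp_all add: push_pm_add push_pm_scale)

lemma pm_induct [case_names single add]:
  fixes f :: "'a \<Rightarrow>\<^sub>0 complex"
  assumes single: "\<And>a c. P (Poly_Mapping.single a c)"
    and add: "\<And>f g. P f \<Longrightarrow> P g \<Longrightarrow> P (f + g)"
  shows "P f"
proof -
  have zero: "P 0" using single[of undefined 0] by simp
  have "P (\<Sum>k\<in>K. Poly_Mapping.single k (Poly_Mapping.lookup f k))" if "finite K" for K
    using that by induction (auto intro: zero single add)
  moreover have "(\<Sum>k\<in>Poly_Mapping.keys f. Poly_Mapping.single k (Poly_Mapping.lookup f k)) = f"
    by (rule poly_mapping_eqI) (simp add: lookup_sum lookup_single when_def sum.delta in_keys_iff)
  ultimately show ?thesis by (metis finite_keys)
qed

lemma push_pm_id [simp]: "push_pm id f = f" "push_pm (\<lambda>x. x) f = f"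
  by (induction f rule: pm_induct) (simp_all add: push_pm_add)

lemma push_pm_comp: "push_pm g (push_pm h f) = push_pm (g \<circ> h) f"
  by (induction f rule: pm_induct) (simp_all add: push_pm_add)


section \<open>The algebra \<open>B(k)\<close>\<close>

text \<open>
  Colours are the elements of a type \<open>'c\<close>, so that \<open>B(k)\<close> is \<open>'c balg\<close> with \<open>CARD('c) = k\<close>.
  Words form a monoid under concatenation, written additively; convolution then
  makes \<open>'a fmon \<Rightarrow>\<^sub>0 complex\<close> the free unital associative algebra on \<open>'a\<close>.
\<close>

datatype 'a fmon = Fmon (letters: "'a list")

instantiation fmon :: (type) monoid_add
begin

definition zero_fmon :: "'a fmon" where "0 = Fmon []"
definition plus_fmon :: "'a fmon \<Rightarrow> 'a fmon \<Rightarrow> 'a fmon" where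
  "u + w = Fmon (letters u @ letters w)"

instance by standard (simp_all add: zero_fmon_def plus_fmon_def)

end

type_synonym 'a free_alg = "'a fmon \<Rightarrow>\<^sub>0 complex"

definition free_gen :: "'c \<Rightarrow> int \<Rightarrow> ('c \<times> int) free_alg" where
  "free_gen p i = pt (Fmon [(p, i)])"

definition anticomm :: "'a::ring \<Rightarrow> 'a \<Rightarrow> 'a" where
  "anticomm a b = a * b + b * a"

text \<open>The two-sided ideal generated by the defining relations; it is closed under scalars
  because \<open>a\<close> may absorb them.\<close>

inductive_set rel_ideal :: "('c \<times> int) free_alg set" where
  rel_zero: "0 \<in> rel_ideal"
| rel_add: "x \<in> rel_ideal \<Longrightarrow> y \<in> rel_ideal \<Longrightarrow> x + y \<in> rel_ideal"
| rel_gen: "a * (anticomm (free_gen p i) (free_gen q j)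
      - anticomm (free_gen p (i + 1)) (free_gen q (j - 1))) * b \<in> rel_ideal"

lemma rel_ideal_mult_left: "x \<in> rel_ideal \<Longrightarrow> y * x \<in> rel_ideal"
proof (induction rule: rel_ideal.induct)
  case (rel_gen a p i q j b)
  show ?case using rel_ideal.rel_gen[of "y * a" p i q j b] by (simp only: mult.assoc)
qed (simp_all add: rel_ideal.intros distrib_left)

lemma rel_ideal_mult_right: "x \<in> rel_ideal \<Longrightarrow> x * y \<in> rel_ideal"
proof (induction rule: rel_ideal.induct)
  case (rel_gen a p i q j b)
  show ?case using rel_ideal.rel_gen[of a p i q j "b * y"] by (simp only: mult.assoc)
qed (simp_all add: rel_ideal.intros distrib_right)

lemma rel_ideal_uminus: "x \<in> rel_ideal \<Longrightarrow> - x \<in> rel_ideal"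
  using rel_ideal_mult_left[of x "- 1"] by simp

lemma rel_ideal_diff: "x \<in> rel_ideal \<Longrightarrow> y \<in> rel_ideal \<Longrightarrow> x - y \<in> rel_ideal"
  using rel_add[of x "- y"] rel_ideal_uminus[of y] by simp

definition balg_rel :: "('c \<times> int) free_alg \<Rightarrow> ('c \<times> int) free_alg \<Rightarrow> bool" where
  "balg_rel x y \<longleftrightarrow> x - y \<in> rel_ideal"

lemma balg_rel_equivp: "equivp balg_rel"
proof (rule equivpI)
  show "reflp balg_rel" by (simp add: reflp_def balg_rel_def rel_zero)
  show "symp balg_rel"
    unfolding symp_def balg_rel_def by (intro allI impI, drule rel_ideal_uminus) simp
  show "transp balg_rel"
    unfolding transp_def balg_rel_def by (intro allI impI, drule (1) rel_add) simp
qed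

quotient_type 'c balg = "('c \<times> int) free_alg" / balg_rel
  by (rule balg_rel_equivp)

instantiation balg :: (type) ring
begin

lift_definition zero_balg :: "'c balg" is 0 .
lift_definition plus_balg :: "'c balg \<Rightarrow> 'c balg \<Rightarrow> 'c balg" is "(+)"
  unfolding balg_rel_def by (simp only: add_diff_add rel_add)
lift_definition uminus_balg :: "'c balg \<Rightarrow> 'c balg" is uminus
  unfolding balg_rel_def by (drule rel_ideal_uminus) simp
lift_definition minus_balg :: "'c balg \<Rightarrow> 'c balg \<Rightarrow> 'c balg" is "(-)"
  unfolding balg_rel_def by (drule (1) rel_ideal_diff) (simp add: algebra_simps)
lift_definition times_balg :: "'c balg \<Rightarrow> 'c balg \<Rightarrow> 'c balg" is "(*)"
proof -
  fix a a' b b' :: "('c \<times> int) free_alg"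
  assume "balg_rel a a'" "balg_rel b b'"
  then have "(a - a') * b + a' * (b - b') \<in> rel_ideal"
    unfolding balg_rel_def by (intro rel_add rel_ideal_mult_left rel_ideal_mult_right)
  then show "balg_rel (a * b) (a' * b')"
    unfolding balg_rel_def by (simp add: algebra_simps)
qed

instance
  by standard (transfer; simp add: balg_rel_def algebra_simps rel_zero)+

end

lift_definition scale_balg :: "complex \<Rightarrow> 'c balg \<Rightarrow> 'c balg" is scale_pm
proof -
  fix c and x y :: "('c \<times> int) free_alg"
  assume "balg_rel x y"
  then have "Poly_Mapping.single 0 c * (x - y) \<in> rel_ideal"
    unfolding balg_rel_def by (rule rel_ideal_mult_left)
  then show "balg_rel (scale_pm c x) (scale_pm c y)"
    unfolding balg_rel_def
    by (simp add: scale_pm_def mult_map_scale_conv_mult algebra_simps)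
qed

interpretation balg: vector_space "scale_balg :: complex \<Rightarrow> 'c balg \<Rightarrow> 'c balg"
  by unfold_locales
    (transfer; simp add: balg_rel_def rel_zero pm.scale_right_distrib pm.scale_left_distrib)+

instantiation balg :: (type) one
begin
lift_definition one_balg :: "'c balg" is 1 .
instance ..
end

lift_definition gen :: "'c \<Rightarrow> int \<Rightarrow> 'c balg" is free_gen .

lemma gen_relation:
  "anticomm (gen p i) (gen q j) = anticomm (gen p (i + 1)) (gen q (j - 1))"
  unfolding anticomm_def
  by transfer (use rel_gen[of 1 _ _ _ _ 1] in \<open>simp add: balg_rel_def anticomm_def\<close>)

text \<open>The algebra homomorphism to the ground field that sends every generator to zero:
  the coefficient of the empty word.\<close>

lemma lookup_mult_Fmon_Nil:
  fixes x y :: "'a free_alg"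
  shows "Poly_Mapping.lookup (x * y) 0 = Poly_Mapping.lookup x 0 * Poly_Mapping.lookup y 0"
proof -
  have nil: "u + w = 0 \<longleftrightarrow> u = 0 \<and> w = 0" for u w :: "'a fmon"
    by (cases u; cases w) (auto simp: zero_fmon_def plus_fmon_def)
  show ?thesis
  proof (induction x rule: pm_induct)
    case (single u c)
    show ?case
    proof (induction y rule: pm_induct)
      case (single w d)
      then show ?case
        by (auto simp: mult_single lookup_single when_def nil)
    qed (simp add: distrib_left lookup_add)
  qed (simp add: distrib_right lookup_add)
qed

lemma lookup_free_gen_zero: "Poly_Mapping.lookup (free_gen p i) 0 = 0"
  by (simp add: free_gen_def lookup_single when_def zero_fmon_def)

lemma rel_ideal_const: "x \<in> rel_ideal \<Longrightarrow> Poly_Mapping.lookup x 0 = 0"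
  by (induction rule: rel_ideal.induct)
    (simp_all add: lookup_add lookup_minus lookup_mult_Fmon_Nil anticomm_def lookup_free_gen_zero)

lift_definition augmentation :: "'c balg \<Rightarrow> complex" is "\<lambda>x. Poly_Mapping.lookup x 0"
  unfolding balg_rel_def by (drule rel_ideal_const) (simp add: lookup_minus)

lemma augmentation_hom:
  "augmentation 1 = 1"
  "augmentation (gen p i) = 0"
  "augmentation (x + y) = augmentation x + augmentation y"
  "augmentation (x * y) = augmentation x * augmentation y"
  "augmentation (scale_balg c x) = c * augmentation x"
  by (transfer; simp add: lookup_add lookup_mult_Fmon_Nil lookup_free_gen_zero)+

instance balg :: (type) ring_1
proof
  have "augmentation (0 :: 'a balg) = 0"
    by transfer simp
  then show "(0 :: 'a balg) \<noteq> 1"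
    by (metis augmentation_hom(1) zero_neq_one)
qed (transfer; simp add: balg_rel_def rel_zero)+

lemma scale_pm_mult:
  fixes a b :: "'a free_alg"
  shows "scale_pm c a * b = scale_pm c (a * b)" "a * scale_pm c b = scale_pm c (a * b)"
proof -
  show "scale_pm c a * b = scale_pm c (a * b)"
    by (simp add: scale_pm_def mult_map_scale_conv_mult mult.assoc)
  show "a * scale_pm c b = scale_pm c (a * b)"
  proof (induction a rule: pm_induct)
    case (single u d)
    show ?case
    proof (induction b rule: pm_induct)
      case (single w e)
      show ?case by (simp add: mult_single mult.left_commute)
    next
      case (add b b')
      then show ?case by (simp only: pm.scale_right_distrib distrib_left)
    qed
  next
    case (add a a')
    then show ?case by (simp only: distrib_right pm.scale_right_distrib)
  qed
qed

lemma scale_balg_mult: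
  "scale_balg c x * y = scale_balg c (x * y)"
  "x * scale_balg c y = scale_balg c (x * y)"
  by (transfer; simp only: scale_pm_mult balg_rel_def diff_self rel_zero)+

inductive_set balg_pos :: "'c balg set" where
  pos_one: "1 \<in> balg_pos"
| pos_gen: "i > 0 \<Longrightarrow> gen p i \<in> balg_pos"
| pos_add: "x \<in> balg_pos \<Longrightarrow> y \<in> balg_pos \<Longrightarrow> x + y \<in> balg_pos"
| pos_mult: "x \<in> balg_pos \<Longrightarrow> y \<in> balg_pos \<Longrightarrow> x * y \<in> balg_pos"
| pos_scale: "x \<in> balg_pos \<Longrightarrow> scale_balg c x \<in> balg_pos"


section \<open>Permuting colours in the algebra\<close>

definition relabel :: "('c \<Rightarrow> 'c) \<Rightarrow> ('c \<times> int) fmon \<Rightarrow> ('c \<times> int) fmon" where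
  "relabel \<sigma> u = Fmon (map (apfst \<sigma>) (letters u))"

lemma relabel_add: "relabel \<sigma> (u + w) = relabel \<sigma> u + relabel \<sigma> w"
  by (simp add: relabel_def plus_fmon_def)

lemma push_relabel_mult:
  "push_pm (relabel \<sigma>) (x * y) = push_pm (relabel \<sigma>) x * push_pm (relabel \<sigma>) y"
proof (induction x rule: pm_induct)
  case (single u c)
  show ?case
    by (induction y rule: pm_induct)
      (simp_all add: mult_single relabel_add distrib_left push_pm_add)
qed (simp add: distrib_right push_pm_add)

lemma push_relabel_gen: "push_pm (relabel \<sigma>) (free_gen p i) = free_gen (\<sigma> p) i"
  by (simp add: free_gen_def relabel_def)

lemma push_relabel_ideal: "x \<in> rel_ideal \<Longrightarrow> push_pm (relabel \<sigma>) x \<in> rel_ideal"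
  by (induction rule: rel_ideal.induct)
    (simp_all add: push_pm_add push_pm_diff push_relabel_mult push_relabel_gen anticomm_def
      rel_ideal.intros rel_gen[unfolded anticomm_def])

lift_definition recolour_balg :: "('c \<Rightarrow> 'c) \<Rightarrow> 'c balg \<Rightarrow> 'c balg"
  is "\<lambda>\<sigma>. push_pm (relabel \<sigma>)"
  unfolding balg_rel_def push_pm_diff[symmetric] by (rule push_relabel_ideal)

lemma recolour_balg_hom:
  "recolour_balg \<sigma> 1 = 1"
  "recolour_balg \<sigma> (gen p i) = gen (\<sigma> p) i"
  "recolour_balg \<sigma> (x + y) = recolour_balg \<sigma> x + recolour_balg \<sigma> y"
  "recolour_balg \<sigma> (x * y) = recolour_balg \<sigma> x * recolour_balg \<sigma> y"
  "recolour_balg \<sigma> (scale_balg c x) = scale_balg c (recolour_balg \<sigma> x)"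
proof -
  show "recolour_balg \<sigma> 1 = 1"
    by transfer (simp add: balg_rel_def rel_zero relabel_def zero_fmon_def flip: single_one)
qed (transfer; simp add: balg_rel_def rel_zero push_relabel_gen push_pm_add push_pm_scale
      push_relabel_mult)+

lemma recolour_balg_pos: "x \<in> balg_pos \<Longrightarrow> recolour_balg \<sigma> x \<in> balg_pos"
  by (induction rule: balg_pos.induct) (simp_all add: recolour_balg_hom balg_pos.intros)

lemma augmentation_recolour: "augmentation (recolour_balg \<sigma> x) = augmentation x"
proof transfer
  fix \<sigma> and x :: "('a \<times> int) free_alg"
  have "relabel \<sigma> u = 0 \<longleftrightarrow> u = 0" for u :: "('a \<times> int) fmon"
    by (cases u) (simp add: relabel_def zero_fmon_def)
  then show "Poly_Mapping.lookup (push_pm (relabel \<sigma>) x) 0 = Poly_Mapping.lookup x 0"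
    by (induction x rule: pm_induct) (simp_all add: push_pm_add lookup_add lookup_single when_def)
qed

(* from here on only the module is lifted; otherwise \<open>balg\<close> inside pairs would be lifted too *)
lifting_forget balg.lifting


section \<open>The induced module\<close>

text \<open>
  The tensor product of the trivial module \<open>complex\<close>, on which \<open>a\<close> in \<open>balg_pos\<close> acts as
  \<open>m \<mapsto> m * augmentation a\<close>, with the algebra over \<open>balg_pos\<close>: the free vector space
  on pairs modulo bilinearity and balancedness.
\<close>

definition tensor_rels :: "((complex \<times> 'c balg) \<Rightarrow>\<^sub>0 complex) set" where
  "tensor_rels =
     {pt (m + m', b) - pt (m, b) - pt (m', b) | m m' b. True}
   \<union> {pt (m, b + b') - pt (m, b) - pt (m, b') | m b b'. True}
   \<union> {pt (c * m, b) - scale_pm c (pt (m, b)) | c m b. True}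
   \<union> {pt (m, scale_balg c b) - scale_pm c (pt (m, b)) | c m b. True}
   \<union> {pt (m * augmentation a, b) - pt (m, a * b) | m a b. a \<in> balg_pos}"

definition fock_rel ::
    "((complex \<times> 'c balg) \<Rightarrow>\<^sub>0 complex) \<Rightarrow> ((complex \<times> 'c balg) \<Rightarrow>\<^sub>0 complex) \<Rightarrow> bool" where
  "fock_rel x y \<longleftrightarrow> x - y \<in> pm.span tensor_rels"

lemma fock_rel_equivp: "equivp fock_rel"
proof (rule equivpI)
  show "reflp fock_rel" by (simp add: reflp_def fock_rel_def pm.span_zero)
  show "symp fock_rel"
    unfolding symp_def fock_rel_def by (intro allI impI, drule pm.span_neg) simp
  show "transp fock_rel"
    unfolding transp_def fock_rel_def by (intro allI impI, drule (1) pm.span_add) simp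
qed

quotient_type 'c fock = "(complex \<times> 'c balg) \<Rightarrow>\<^sub>0 complex" / fock_rel
  by (rule fock_rel_equivp)

instantiation fock :: (type) ab_group_add
begin

lift_definition zero_fock :: "'c fock" is 0 .
lift_definition plus_fock :: "'c fock \<Rightarrow> 'c fock \<Rightarrow> 'c fock" is "(+)"
  unfolding fock_rel_def by (simp only: add_diff_add pm.span_add)
lift_definition uminus_fock :: "'c fock \<Rightarrow> 'c fock" is uminus
  unfolding fock_rel_def by (drule pm.span_neg) simp
lift_definition minus_fock :: "'c fock \<Rightarrow> 'c fock \<Rightarrow> 'c fock" is "(-)"
  unfolding fock_rel_def by (drule (1) pm.span_diff) (simp add: algebra_simps)

instance
  by standard (transfer; simp add: fock_rel_def algebra_simps pm.span_zero)+

end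

lift_definition scale_fock :: "complex \<Rightarrow> 'c fock \<Rightarrow> 'c fock" is scale_pm
  unfolding fock_rel_def by (metis pm.span_scale pm.scale_right_diff_distrib)

interpretation fock: vector_space "scale_fock :: complex \<Rightarrow> 'c fock \<Rightarrow> 'c fock"
  by unfold_locales
    (transfer; simp add: fock_rel_def pm.span_zero pm.scale_right_distrib pm.scale_left_distrib)+

lift_definition tensor :: "complex \<Rightarrow> 'c balg \<Rightarrow> 'c fock" is "\<lambda>m b. pt (m, b)" .

lemma tensor_bilinear:
  "tensor (m + m') b = tensor m b + tensor m' b"
  "tensor m (b + b') = tensor m b + tensor m b'"
  "tensor (c * m) b = scale_fock c (tensor m b)"
  "tensor m (scale_balg c b) = scale_fock c (tensor m b)"
  by (transfer, unfold fock_rel_def tensor_rels_def diff_diff_eq[symmetric],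
      rule pm.span_base, blast)+

lemma tensor_balanced:
  assumes "a \<in> balg_pos"
  shows "tensor (m * augmentation a) b = tensor m (a * b)"
  using assms
  by (transfer, unfold fock_rel_def tensor_rels_def, intro pm.span_base, blast)

lemma push_pm_fock_rel:
  assumes rels: "\<And>t. t \<in> tensor_rels \<Longrightarrow> push_pm g t \<in> pm.span tensor_rels"
    and "fock_rel x y"
  shows "fock_rel (push_pm g x) (push_pm g y)"
proof -
  interpret l: Vector_Spaces.linear scale_pm scale_pm "push_pm g" by (rule push_pm_linear)
  have "push_pm g ` pm.span tensor_rels = pm.span (push_pm g ` tensor_rels)"
    by (rule l.span_image[symmetric])
  also have "\<dots> \<subseteq> pm.span tensor_rels"
    by (rule pm.span_minimal) (use rels in auto)
  finally show ?thesis
    using assms(2) unfolding fock_rel_def push_pm_diff[symmetric] by blast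
qed

lemma push_pm_tensor_rels:
  fixes h :: "'c balg \<Rightarrow> 'c balg"
  assumes add: "\<And>b b'. h (b + b') = h b + h b'"
    and scale: "\<And>c b. h (scale_balg c b) = scale_balg c (h b)"
    and mult: "\<And>a b. a \<in> balg_pos \<Longrightarrow>
      \<exists>a'\<in>balg_pos. augmentation a' = augmentation a \<and> h (a * b) = a' * h b"
    and t: "t \<in> tensor_rels"
  shows "push_pm (\<lambda>(m, b). (m, h b)) t \<in> tensor_rels"
proof -
  let ?P = "push_pm (\<lambda>(m, b). (m, h b))"
  from t consider
      (1) m m' b where "t = pt (m + m', b) - pt (m, b) - pt (m', b)"
    | (2) m b b' where "t = pt (m, b + b') - pt (m, b) - pt (m, b')"
    | (3) c m b where "t = pt (c * m, b) - scale_pm c (pt (m, b))"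
    | (4) c m b where "t = pt (m, scale_balg c b) - scale_pm c (pt (m, b))"
    | (5) m a b where "a \<in> balg_pos" "t = pt (m * augmentation a, b) - pt (m, a * b)"
    unfolding tensor_rels_def by blast
  then show ?thesis
  proof cases
    case 1
    then have "?P t = pt (m + m', h b) - pt (m, h b) - pt (m', h b)"
      by (simp add: push_pm_diff)
    then show ?thesis unfolding tensor_rels_def by blast
  next
    case 2
    then have "?P t = pt (m, h b + h b') - pt (m, h b) - pt (m, h b')"
      by (simp add: push_pm_diff add)
    then show ?thesis unfolding tensor_rels_def by blast
  next
    case 3
    then have "?P t = pt (c * m, h b) - scale_pm c (pt (m, h b))"
      by (simp add: push_pm_diff)
    then show ?thesis unfolding tensor_rels_def by blast
  next
    case 4
    then have "?P t = pt (m, scale_balg c (h b)) - scale_pm c (pt (m, h b))"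
      by (simp add: push_pm_diff scale)
    then show ?thesis unfolding tensor_rels_def by blast
  next
    case 5
    obtain a' where "a' \<in> balg_pos" "augmentation a' = augmentation a" "h (a * b) = a' * h b"
      using mult[OF 5(1)] by blast
    moreover from this 5 have "?P t = pt (m * augmentation a', h b) - pt (m, a' * h b)"
      by (simp add: push_pm_diff)
    ultimately show ?thesis unfolding tensor_rels_def by blast
  qed
qed

lift_definition act :: "'c fock \<Rightarrow> 'c balg \<Rightarrow> 'c fock"
  is "\<lambda>w x. push_pm (\<lambda>(m, b). (m, b * x)) w"
  by (rule push_pm_fock_rel)
    (auto intro!: pm.span_base push_pm_tensor_rels simp: distrib_right scale_balg_mult mult.assoc)

lemma act_tensor: "act (tensor m b) x = tensor m (b * x)"
  by transfer (simp add: fock_rel_def pm.span_zero)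

lemma act_linear:
  "act (w + w') x = act w x + act w' x"
  "act (scale_fock c w) x = scale_fock c (act w x)"
  by (transfer; simp add: push_pm_add push_pm_scale fock_rel_def pm.span_zero)+

lemma act_one: "act w 1 = w"
  by transfer (simp add: fock_rel_def pm.span_zero)

lemma act_mult: "act w (x * y) = act (act w x) y"
  by transfer
    (simp add: fock_rel_def pm.span_zero push_pm_comp comp_def case_prod_unfold mult.assoc)

definition vac :: "'c fock" where
  "vac = tensor 1 1"

lemma vac_gen_pos:
  assumes "i > 0" shows "act vac (gen p i) = 0"
  using tensor_balanced[OF pos_gen[OF assms, of p], of 1 1, symmetric] tensor_bilinear(3)[of 0 0 1]
  by (simp add: vac_def act_tensor augmentation_hom)

definition monomial :: "('c \<times> int) list \<Rightarrow> 'c fock" where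
  "monomial ws = foldl (\<lambda>w (p, i). act w (gen p i)) vac ws"

definition Q :: "nat \<Rightarrow> 'c fock set" where
  "Q n = fock.span {monomial ws | ws. length ws = n \<and> (\<forall>(p, i)\<in>set ws. i \<ge> 0)}"

text \<open>Here the number of colours and the length of the monomials are both \<open>CARD('n)\<close>.\<close>

definition Q_multi :: "'n::finite fock set" where
  "Q_multi = fock.span {monomial ws | ws. length ws = CARD('n) \<and> (\<forall>(p, i)\<in>set ws. i \<ge> 0)
      \<and> (\<forall>p. count_list (map fst ws) p = 1)}"

lemma Q_multi_subset: "(Q_multi :: 'n::finite fock set) \<subseteq> Q CARD('n)"
  unfolding Q_multi_def Q_def by (rule fock.span_mono) auto


section \<open>Permuting colours in the module\<close>

lift_definition recolour :: "('c \<Rightarrow> 'c) \<Rightarrow> 'c fock \<Rightarrow> 'c fock"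
  is "\<lambda>\<sigma>. push_pm (\<lambda>(m, b). (m, recolour_balg \<sigma> b))"
  by (rule push_pm_fock_rel)
    (auto intro!: pm.span_base push_pm_tensor_rels
      simp: recolour_balg_hom intro: recolour_balg_pos augmentation_recolour)

lemma recolour_linear:
  "recolour \<sigma> (w + w') = recolour \<sigma> w + recolour \<sigma> w'"
  "recolour \<sigma> (scale_fock c w) = scale_fock c (recolour \<sigma> w)"
  by (transfer; simp add: push_pm_add push_pm_scale fock_rel_def pm.span_zero)+

lemma recolour_act: "recolour \<sigma> (act w x) = act (recolour \<sigma> w) (recolour_balg \<sigma> x)"
  by transfer
    (simp add: fock_rel_def pm.span_zero push_pm_comp comp_def case_prod_unfold recolour_balg_hom)

lemma recolour_vac: "recolour \<sigma> vac = vac"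
  unfolding vac_def
  by transfer (simp add: fock_rel_def pm.span_zero recolour_balg_hom)

lemma recolour_monomial: "recolour \<sigma> (monomial ws) = monomial (map (apfst \<sigma>) ws)"
  unfolding monomial_def
  by (induction ws rule: rev_induct)
    (simp_all add: recolour_vac recolour_act recolour_balg_hom case_prod_unfold)

lemma recolour_Q_multi:
  fixes \<sigma> :: "'n::finite \<Rightarrow> 'n"
  assumes "bij \<sigma>" and "w \<in> Q_multi"
  shows "recolour \<sigma> w \<in> Q_multi"
proof -
  let ?S = "{monomial ws | ws. length ws = CARD('n) \<and> (\<forall>(p, i)\<in>set ws. i \<ge> 0)
      \<and> (\<forall>p. count_list (map fst ws) p = 1)}"
  interpret l: Vector_Spaces.linear scale_fock scale_fock "recolour \<sigma>"
    by unfold_locales (simp_all add: recolour_linear)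
  have count: "count_list (map fst (map (apfst \<sigma>) ws)) p = count_list (map fst ws) (inv \<sigma> p)"
    for p and ws :: "('n \<times> int) list"
    by (induction ws) (use assms(1) in \<open>auto simp: bij_inv_eq_iff\<close>)
  have "recolour \<sigma> ` ?S \<subseteq> ?S"
  proof clarify
    fix ws :: "('n \<times> int) list"
    assume ws: "length ws = CARD('n)" "\<forall>(p, i)\<in>set ws. 0 \<le> i" "\<forall>p. count_list (map fst ws) p = 1"
    have "\<forall>p. count_list (map fst (map (apfst \<sigma>) ws)) p = 1"
      using ws(3) by (simp only: count) simp
    with ws(1,2) show "\<exists>ws'. recolour \<sigma> (monomial ws) = monomial ws' \<and> length ws' = CARD('n)
        \<and> (\<forall>(p, i)\<in>set ws'. 0 \<le> i) \<and> (\<forall>p. count_list (map fst ws') p = 1)"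
      by (intro exI[of _ "map (apfst \<sigma>) ws"]) (auto simp: recolour_monomial)
  qed
  then have "fock.span (recolour \<sigma> ` ?S) \<subseteq> fock.span ?S"
    by (rule fock.span_mono)
  then show ?thesis
    using assms(2) l.span_image[of ?S] unfolding Q_multi_def by blast
qed


section \<open>Parking functions\<close>

text \<open>The arguments range over \<open>'n\<close>, the values over \<open>{1..n}\<close> with \<open>n = CARD('n)\<close>.\<close>

definition parking_functions :: "('n::finite \<Rightarrow> nat) set" where
  "parking_functions = {f. range f \<subseteq> {1..CARD('n)}
      \<and> (\<forall>j\<in>{1..CARD('n)}. card (f -` {1..j}) \<ge> j)}"

definition PF :: "(('n::finite \<Rightarrow> nat) \<Rightarrow>\<^sub>0 complex) set" where
  "PF = pm.span (pt ` parking_functions)"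

definition PF_act ::
    "('n \<Rightarrow> 'n) \<Rightarrow> (('n \<Rightarrow> nat) \<Rightarrow>\<^sub>0 complex) \<Rightarrow> (('n \<Rightarrow> nat) \<Rightarrow>\<^sub>0 complex)" where
  "PF_act \<sigma> = push_pm (\<lambda>f. f \<circ> inv \<sigma>)"

definition rep_isomorphic ::
    "'g set \<Rightarrow> (complex \<Rightarrow> 'v \<Rightarrow> 'v::ab_group_add) \<Rightarrow> 'v set \<Rightarrow> ('g \<Rightarrow> 'v \<Rightarrow> 'v)
      \<Rightarrow> (complex \<Rightarrow> 'w \<Rightarrow> 'w::ab_group_add) \<Rightarrow> 'w set \<Rightarrow> ('g \<Rightarrow> 'w \<Rightarrow> 'w) \<Rightarrow> bool" where
  "rep_isomorphic G sV V aV sW W aW \<longleftrightarrow>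
    (\<exists>\<phi>. bij_betw \<phi> V W
       \<and> (\<forall>x\<in>V. \<forall>y\<in>V. \<phi> (x + y) = \<phi> x + \<phi> y)
       \<and> (\<forall>c. \<forall>x\<in>V. \<phi> (sV c x) = sW c (\<phi> x))
       \<and> (\<forall>g\<in>G. \<forall>x\<in>V. \<phi> (aV g x) = aW g (\<phi> x)))"

end

theory Submission
  imports Defs "HOL-Library.FuncSet"
begin

text \<open>
  The module is studied through its dual. Put \<open>n = CARD('n)\<close>. In a word with letters
  \<open>(p\<^sub>1, i\<^sub>1), \<dots>, (p\<^sub>n, i\<^sub>n)\<close> whose colours \<open>p\<^sub>1, \<dots>, p\<^sub>n\<close> are distinct, read \<open>i\<^sub>s\<close> as the exponent of a
  variable \<open>z\<close> attached to the colour \<open>p\<^sub>s\<close>. Send the word to the coefficient of its monomial in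
  the rational function
  \<open>\<Prod>\<^sub>p z\<^sub>p^(a p) / \<Prod>\<^sub>s\<^sub><\<^sub>t (z\<^sub>p\<^sub>s - z\<^sub>p\<^sub>t)\<close>, expanded in the region \<open>\<bar>z\<^sub>p\<^sub>1\<bar> > \<bar>z\<^sub>p\<^sub>2\<bar> > \<dots>\<close>. Interchanging
  two neighbouring colours \<open>p, q\<close> changes the sign of the function and the region of one factor, so
  the sum of the two expansions is a multiple of the formal delta function at \<open>z\<^sub>p = z\<^sub>q\<close>; this is
  what the relations of the algebra ask for (\<open>coef_relation\<close>). If all exponents \<open>a p\<close> are at
  most \<open>n - 1\<close>, no positive power of the first variable occurs, so the functional also
  respects the vacuum. A parking function \<open>b\<close> gives the functional with \<open>a p = n - b p\<close>, and
  all of these together form the map \<open>to_PF\<close>. It is equivariant by construction, because permuting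
  the colours of a word permutes the exponents.

  It remains to see that \<open>to_PF\<close> is bijective on \<open>Q_multi\<close>. Arrange the colours by increasing value
  of \<open>b\<close>, with ties broken by a fixed enumeration of the colours, and let the \<open>s\<close>-th letter have
  exponent \<open>s - b p\<^sub>s\<close>; that these are nonnegative is the parking condition. This is the
  \<open>normal_word\<close> of \<open>b\<close>. Two facts finish the proof.

  \<^item> Triangularity (\<open>word_value_normal_triangular\<close>): expanding only moves exponents from earlier to
    later variables, so \<open>a'\<close> can contribute to the normal word of \<open>b\<close> only if it dominates the
    exponents \<open>a = n - b\<close>; then \<open>\<Sum>\<^sub>p (a' p)\<^sup>2 > \<Sum>\<^sub>p (a p)\<^sup>2\<close> unless \<open>a' = a\<close>. Hence the matrix of
    functionals against normal words is unitriangular.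

  \<^item> Spanning (\<open>monomial_in_span_normal\<close>): a word that starts with a positive exponent vanishes,
    and the defining relation rewrites any other word that is not normal into words whose
    exponents, with ties broken by the colours, lie further to the left.

  So the monomials of the normal words are a basis of \<open>Q_multi\<close> and \<open>to_PF\<close> is an isomorphism. The number of
  parking functions is found by Pollak's argument: place the \<open>n\<close> cars on a circle with \<open>n + 1\<close>
  spots; then exactly one of the \<open>n + 1\<close> rotations of any preference function is parking.
\<close>

section \<open>Coefficients of the expansion\<close>

definition compositions :: "'c set \<Rightarrow> int \<Rightarrow> ('c \<Rightarrow> nat) set" where
  "compositions S m = {k. (\<forall>x. x \<notin> S \<longrightarrow> k x = 0) \<and> int (sum k S) = m}"

text \<open>Read a function \<open>g\<close> of exponents as a linear functional on Laurent polynomials, given by its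
  values on the monomials. Then this is the functional \<open>f \<mapsto> g (h\<^sub>m f)\<close>, where \<open>h\<^sub>m\<close> is the complete homogeneous symmetric polynomial of
  degree \<open>m\<close> in the variables with index in \<open>S\<close>; it vanishes for negative \<open>m\<close>.\<close>

definition complete_shift :: "'c set \<Rightarrow> int \<Rightarrow> (('c \<Rightarrow> int) \<Rightarrow> complex) \<Rightarrow> ('c \<Rightarrow> int) \<Rightarrow> complex" where
  "complete_shift S m g a = (\<Sum>k\<in>compositions S m. g (\<lambda>x. a x + int (k x)))"

text \<open>The expansion coefficient described at the beginning. For the first variable \<open>z\<close> and the
  set \<open>S\<close> of remaining ones, \<open>z^a / \<Prod>\<^sub>y (z - y) = \<Sum>\<^sub>m h\<^sub>m(S) z^(a - card S - m)\<close>; asking for the exponent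
  \<open>i\<close> of \<open>z\<close> fixes \<open>m = a - card S - i\<close>, and the remaining word is evaluated after multiplication
  by \<open>h\<^sub>m(S)\<close>. The empty word has value one because by then every exponent has been compared.\<close>

primrec coef :: "('c \<times> int) list \<Rightarrow> ('c \<Rightarrow> int) \<Rightarrow> complex" where
  "coef [] = (\<lambda>a. 1)"
| "coef (x # w) = (\<lambda>a. complete_shift (fst ` set w) (a (fst x) - int (length w) - snd x) (coef w) a)"

lemma compositions_neg: "m < 0 \<Longrightarrow> compositions S m = {}"
  unfolding compositions_def by (auto simp del: of_nat_sum)

lemma complete_shift_neg: "m < 0 \<Longrightarrow> complete_shift S m g = (\<lambda>_. 0)"
  by (simp add: complete_shift_def compositions_neg fun_eq_iff)

lemma complete_shift_of_zero: "complete_shift S m (\<lambda>_. 0) a = 0"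
  by (simp add: complete_shift_def)

lemma compositions_zero: "finite S \<Longrightarrow> compositions S 0 = {\<lambda>x. 0}"
  unfolding compositions_def by (auto simp: fun_eq_iff simp del: of_nat_sum)

lemma complete_shift_zero: "finite S \<Longrightarrow> complete_shift S 0 g a = g a"
  by (simp add: complete_shift_def compositions_zero)

lemma complete_shift_cong:
  assumes "\<And>k. k \<in> compositions S m \<Longrightarrow> g (\<lambda>x. a x + int (k x)) = g' (\<lambda>x. a' x + int (k x))"
  shows "complete_shift S m g a = complete_shift S m g' a'"
  unfolding complete_shift_def by (intro sum.cong refl assms)

lemma complete_shift_add: "complete_shift S m (\<lambda>a. g a + g' a) a = complete_shift S m g a + complete_shift S m g' a"
  by (simp add: complete_shift_def sum.distrib)

lemma complete_shift_commute: "complete_shift S x (complete_shift S y g) a = complete_shift S y (complete_shift S x g) a"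
  unfolding complete_shift_def by (subst sum.swap) (simp add: add_ac)

text \<open>The identity \<open>h\<^sub>m(y, S) = \<Sum>\<^sub>c y^c h\<^sub>m\<^sub>-\<^sub>c(S)\<close>.\<close>

lemma complete_shift_insert:
  assumes "finite S" "q \<notin> S"
  shows "complete_shift (insert q S) m g a = (\<Sum>c\<in>{0..m}. complete_shift S (m - c) g (a(q := a q + c)))"
proof -
  have fin: "finite (compositions S (m - c))" for c
  proof (rule finite_subset)
    show "compositions S (m - c) \<subseteq> {k. \<forall>x. (x \<in> S \<longrightarrow> k x \<in> {..nat (m - c)}) \<and> (x \<notin> S \<longrightarrow> k x = 0)}"
    proof (clarsimp simp: compositions_def simp del: of_nat_sum)
      fix k :: "'a \<Rightarrow> nat" and x assume "int (sum k S) = m - c" "x \<in> S"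
      moreover have "k x \<le> sum k S" using \<open>x \<in> S\<close> assms(1) by (intro member_le_sum) auto
      ultimately show "k x \<le> nat (m - c)" by linarith
    qed
    show "finite {k. \<forall>x. (x \<in> S \<longrightarrow> k x \<in> {..nat (m - c)}) \<and> (x \<notin> S \<longrightarrow> k x = (0::nat))}"
      using assms(1) by (intro finite_set_of_finite_funs) auto
  qed
  have "(\<Sum>c\<in>{0..m}. complete_shift S (m - c) g (a(q := a q + c)))
      = (\<Sum>(c, k)\<in>Sigma {0..m} (\<lambda>c. compositions S (m - c)). g (\<lambda>x. (a(q := a q + c)) x + int (k x)))"
    unfolding complete_shift_def by (rule sum.Sigma) (use fin in auto)
  also have "\<dots> = complete_shift (insert q S) m g a"
    unfolding complete_shift_def
  proof (rule sum.reindex_bij_witness[of _ "\<lambda>k. (int (k q), k(q := 0))" "\<lambda>(c, k). k(q := nat c)"], goal_cases)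
    case (1 z)
    then show ?case using assms(2) by (auto simp: compositions_def fun_eq_iff)
  next
    case (2 z)
    have "sum (\<lambda>x. if x = q then y else h x) S = sum h S" for y and h :: "'a \<Rightarrow> nat"
      using assms(2) by (intro sum.cong) auto
    with 2 show ?case using assms by (auto simp: compositions_def fun_upd_def simp del: of_nat_sum)
  next
    case (3 k)
    then show ?case by auto
  next
    case (4 k)
    have "sum (\<lambda>x. if x = q then 0 else k x) S = sum k S"
      using assms(2) by (intro sum.cong) auto
    with 4 show ?case using assms by (auto simp: compositions_def fun_upd_def simp del: of_nat_sum)
  next
    case (5 z)
    have "(a(q := a q + fst z)) = (\<lambda>x. a x + (if x = q then fst z else 0))" by auto
    with 5 show ?case using assms(2) by (auto simp: compositions_def fun_eq_iff intro!: arg_cong[of _ _ g])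
  qed
  finally show ?thesis by simp
qed

lemma coef_cong:
  "(\<And>x. x \<in> fst ` set w \<Longrightarrow> a x = a' x) \<Longrightarrow> coef w a = coef w a'"
proof (induction w arbitrary: a a')
  case (Cons y w)
  have "complete_shift (fst ` set w) m (coef w) a = complete_shift (fst ` set w) m (coef w) a'" for m
    by (rule complete_shift_cong, rule Cons.IH) (use Cons.prems in auto)
  then show ?case using Cons.prems by simp
qed simp

text \<open>The two leading variables are split off, leaving two complete symmetric polynomials in
  the same set of variables; their degrees run over a half-line of the antidiagonal whose position
  depends on \<open>i + j\<close> only.\<close>

lemma coef_pair:
  assumes "p \<noteq> q" "p \<notin> fst ` set w" "q \<notin> fst ` set w"
  shows "coef ((p, i) # (q, j) # w) a
    = (\<Sum>x\<in>{0..a p - int (length w) - i - 1}.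
        complete_shift (fst ` set w) x (complete_shift (fst ` set w)
          (a p + a q - 2 * int (length w) - i - j - 1 - x) (coef w)) a)"
proof -
  let ?R = "fst ` set w" and ?l = "int (length w)"
  let ?m = "a p - ?l - i - 1"
  have inner: "complete_shift ?R (?m - c) (coef ((q, j) # w)) (a(q := a q + c))
      = complete_shift ?R (?m - c) (complete_shift ?R (a q - ?l - j + c) (coef w)) a" for c
  proof (rule complete_shift_cong)
    fix k assume "k \<in> compositions ?R (?m - c)"
    then have "k q = 0" using assms(3) by (auto simp: compositions_def)
    moreover have "complete_shift ?R m (coef w) (\<lambda>x. (a(q := a q + c)) x + int (k x))
        = complete_shift ?R m (coef w) (\<lambda>x. a x + int (k x))" for m
      by (rule complete_shift_cong, rule coef_cong) (use assms(3) in auto)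
    ultimately show "coef ((q, j) # w) (\<lambda>x. (a(q := a q + c)) x + int (k x))
        = complete_shift ?R (a q - ?l - j + c) (coef w) (\<lambda>x. a x + int (k x))"
      by (simp add: algebra_simps)
  qed
  have "coef ((p, i) # (q, j) # w) a = complete_shift (insert q ?R) ?m (coef ((q, j) # w)) a"
    by (simp add: algebra_simps)
  also have "\<dots> = (\<Sum>c\<in>{0..?m}. complete_shift ?R (?m - c) (complete_shift ?R (a q - ?l - j + c) (coef w)) a)"
    using assms(3) by (subst complete_shift_insert) (simp_all only: inner finite_imageI finite_set not_False_eq_True)
  also have "\<dots> = (\<Sum>x\<in>{0..?m}. complete_shift ?R x (complete_shift ?R (a p + a q - 2 * ?l - i - j - 1 - x) (coef w)) a)"
    by (rule sum.reindex_bij_witness[of _ "\<lambda>x. ?m - x" "\<lambda>x. ?m - x"]) (auto simp: algebra_simps)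
  finally show ?thesis .
qed

text \<open>The two complete symmetric polynomials commute, so the half-lines for the two orders of the
  first two letters are complementary parts of the same antidiagonal. Hence the sum depends on
  \<open>i\<close> and \<open>j\<close> through \<open>i + j\<close> alone.\<close>

lemma coef_anticomm:
  assumes "p \<noteq> q" "p \<notin> fst ` set w" "q \<notin> fst ` set w"
  shows "coef ((p, i) # (q, j) # w) a + coef ((q, j) # (p, i) # w) a
    = (\<Sum>x\<in>{0..a p + a q - 2 * int (length w) - i - j - 1}.
        complete_shift (fst ` set w) x (complete_shift (fst ` set w)
          (a p + a q - 2 * int (length w) - i - j - 1 - x) (coef w)) a)"
proof -
  let ?R = "fst ` set w" and ?l = "int (length w)"
  let ?A = "a p - ?l - i"
  define T where "T = a p + a q - 2 * ?l - i - j - 1"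
  define H where "H x = complete_shift ?R x (complete_shift ?R (T - x) (coef w)) a" for x
  have H_out: "H x = 0" if "x < 0 \<or> x > T" for x
    using that unfolding H_def by (auto simp: complete_shift_neg complete_shift_of_zero)
  have sym: "H (T - x) = H x" for x
    unfolding H_def by (subst complete_shift_commute) simp
  have 1: "coef ((p, i) # (q, j) # w) a = (\<Sum>x\<in>{0..?A - 1}. H x)"
    using coef_pair[OF assms, of i j a] by (simp add: H_def T_def)
  have "coef ((q, j) # (p, i) # w) a = (\<Sum>x\<in>{0..a q - ?l - j - 1}. H x)"
    using coef_pair[of q p w j i a] assms by (simp add: H_def T_def algebra_simps)
  \<comment> \<open>the substitution \<open>x = T - y\<close> turns this half-line into the complement of the first one\<close>
  also have "\<dots> = (\<Sum>x\<in>{?A..T}. H x)"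
    by (rule sum.reindex_bij_witness[of _ "\<lambda>x. T - x" "\<lambda>x. T - x"], auto simp: sym) (auto simp: T_def)
  also have "\<dots> = (\<Sum>x\<in>{0..T} - {0..?A - 1}. H x)"
    by (rule sum.mono_neutral_right) (auto intro: H_out)
  finally have 2: "coef ((q, j) # (p, i) # w) a = (\<Sum>x\<in>{0..T} - {0..?A - 1}. H x)" .
  have "(\<Sum>x\<in>{0..?A - 1}. H x) = (\<Sum>x\<in>{0..T} \<inter> {0..?A - 1}. H x)"
    by (rule sum.mono_neutral_right) (auto intro: H_out)
  then have "coef ((p, i) # (q, j) # w) a + coef ((q, j) # (p, i) # w) a = (\<Sum>x\<in>{0..T}. H x)"
    using 1 2 sum.Int_Diff[of "{0..T}" H "{0..?A - 1}"] by simp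
  then show ?thesis by (simp add: H_def T_def)
qed

text \<open>A prefix acts by the same complete shifts on all four words, so that the relation at the front
  of a word implies the relation inside it.\<close>

lemma coef_relation:
  assumes "distinct (map fst (u @ [(p, i), (q, j)] @ w))"
  shows "coef (u @ [(p, i), (q, j)] @ w) a + coef (u @ [(q, j), (p, i)] @ w) a
    = coef (u @ [(p, i + 1), (q, j - 1)] @ w) a + coef (u @ [(q, j - 1), (p, i + 1)] @ w) a"
  using assms
proof (induction u arbitrary: a)
  case Nil
  have T: "a p + a q - 2 * int (length w) - (i + 1) - (j - 1) - 1
      = a p + a q - 2 * int (length w) - i - j - 1" by simp
  have d: "p \<noteq> q" "p \<notin> fst ` set w" "q \<notin> fst ` set w" using Nil by auto
  from coef_anticomm[OF d, of i j a] coef_anticomm[OF d, of "i + 1" "j - 1" a, unfolded T]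
  show ?case by (simp only: append.simps)
next
  case (Cons x u)
  let ?h = "complete_shift (fst ` (set u \<union> {(p, i), (q, j)} \<union> set w)) (a (fst x) - int (length u + 2 + length w) - snd x)"
  have "?h (\<lambda>a. coef (u @ [(p, i), (q, j)] @ w) a + coef (u @ [(q, j), (p, i)] @ w) a) a
    = ?h (\<lambda>a. coef (u @ [(p, i + 1), (q, j - 1)] @ w) a + coef (u @ [(q, j - 1), (p, i + 1)] @ w) a) a"
    by (rule complete_shift_cong, rule Cons.IH) (use Cons.prems in auto)
  then show ?case
    by (simp add: complete_shift_add insert_commute image_Un)
qed

text \<open>The leading term of the expansion: only \<open>h\<^sub>0 = 1\<close> enters at each letter.\<close>

lemma coef_leading:
  "distinct (map fst w) \<Longrightarrow> (\<And>s. s < length w \<Longrightarrow> a (fst (w ! s)) = snd (w ! s) + int (length w - Suc s))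
    \<Longrightarrow> coef w a = 1"
proof (induction w)
  case (Cons x w)
  have "a (fst x) = snd x + int (length w)" using Cons.prems(2)[of 0] by simp
  moreover have "coef w a = 1"
    by (rule Cons.IH) (use Cons.prems(1) Cons.prems(2)[of "Suc _"] in auto)
  ultimately show ?case by (simp add: complete_shift_zero)
qed simp

text \<open>Multiplication by \<open>h\<^sub>m\<close> moves the degree \<open>m\<close> lost by the first variable to later ones,
  which carry smaller weights \<open>c\<close>. With \<open>c\<close> equal to one on an initial segment and zero afterwards
  this is dominance of the exponents; the version with a general decreasing weight can be used
  with the exponents themselves as the weight.\<close>

lemma coef_dominance:
  fixes c :: "'c \<Rightarrow> int"
  assumes "coef w a \<noteq> 0" "sorted_wrt (\<lambda>x y. c (fst x) \<ge> c (fst y)) w" "distinct (map fst w)"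
  shows "(\<Sum>s<length w. c (fst (w ! s)) * (a (fst (w ! s)) - snd (w ! s) - int (length w - Suc s))) \<ge> 0"
  using assms
proof (induction w arbitrary: a)
  case (Cons x w)
  let ?m = "a (fst x) - int (length w) - snd x"
  from Cons.prems(1) obtain k where k: "k \<in> compositions (fst ` set w) ?m"
    and nz: "coef w (\<lambda>x. a x + int (k x)) \<noteq> 0"
    by (auto simp: complete_shift_def elim!: sum.not_neutral_contains_not_neutral)
  have sum_w: "(\<Sum>s<length w. h (fst (w ! s))) = sum h (fst ` set w)" for h :: "'c \<Rightarrow> int"
  proof -
    have "sum h (fst ` set w) = sum h (set (map fst w))" by simp
    also have "\<dots> = sum_list (map h (map fst w))"
      using Cons.prems(3) by (subst sum_list_distinct_conv_sum_set) simp_all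
    also have "\<dots> = (\<Sum>s<length w. h (fst (w ! s)))"
      by (simp add: sum_list_sum_nth atLeast0LessThan)
    finally show ?thesis by simp
  qed
  have "(\<Sum>s<length w. c (fst (w ! s)) * int (k (fst (w ! s)))) = (\<Sum>y\<in>fst ` set w. c y * int (k y))"
    by (rule sum_w)
  also have "\<dots> \<le> (\<Sum>y\<in>fst ` set w. c (fst x) * int (k y))"
    using Cons.prems(2) by (intro sum_mono mult_right_mono) auto
  also have "\<dots> = c (fst x) * ?m"
    using k by (simp add: compositions_def flip: sum_distrib_left)
  finally have 1: "(\<Sum>s<length w. c (fst (w ! s)) * int (k (fst (w ! s)))) \<le> c (fst x) * ?m" .
  have "0 \<le> (\<Sum>s<length w. c (fst (w ! s)) * (a (fst (w ! s)) + int (k (fst (w ! s))) - snd (w ! s) - int (length w - Suc s)))"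
    by (rule Cons.IH[OF nz]) (use Cons.prems in auto)
  also have "\<dots> = (\<Sum>s<length w. c (fst (w ! s)) * (a (fst (w ! s)) - snd (w ! s) - int (length w - Suc s)))
      + (\<Sum>s<length w. c (fst (w ! s)) * int (k (fst (w ! s))))"
    by (simp add: algebra_simps flip: sum.distrib)
  finally show ?case using 1
    by (simp add: sum.lessThan_Suc_shift algebra_simps del: sum.lessThan_Suc)
qed simp

lemma compositions_image:
  fixes \<sigma> :: "'a \<Rightarrow> 'a"
  assumes "bij \<sigma>" "finite S"
  shows "bij_betw (\<lambda>k. k \<circ> inv \<sigma>) (compositions S m) (compositions (\<sigma> ` S) m)"
proof (rule bij_betw_byWitness[where f' = "\<lambda>k. k \<circ> \<sigma>"])
  have inj: "inj \<sigma>" and surj: "surj \<sigma>" using assms(1) by (simp_all add: bij_is_inj bij_is_surj)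
  show "\<forall>k\<in>compositions S m. k \<circ> inv \<sigma> \<circ> \<sigma> = k"
    using inj by (simp add: o_assoc[symmetric])
  show "\<forall>k\<in>compositions (\<sigma> ` S) m. k \<circ> \<sigma> \<circ> inv \<sigma> = k"
    using surj by (simp add: o_assoc[symmetric] surj_iff)
  have "sum (k \<circ> inv \<sigma>) (\<sigma> ` S) = sum k S" for k :: "'a \<Rightarrow> nat"
    using sum.reindex[OF inj_on_subset[OF inj, of S], of "k \<circ> inv \<sigma>"] inj by (simp add: comp_def)
  then show "(\<lambda>k. k \<circ> inv \<sigma>) ` compositions S m \<subseteq> compositions (\<sigma> ` S) m"
  proof (clarsimp simp: compositions_def simp del: of_nat_sum)
    fix k :: "'a \<Rightarrow> nat" and x
    assume k: "\<forall>x. x \<notin> S \<longrightarrow> k x = 0" and "x \<notin> \<sigma> ` S"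
    moreover have "\<sigma> (inv \<sigma> x) = x" using surj by (rule surj_f_inv_f)
    ultimately have "inv \<sigma> x \<notin> S" by force
    then show "k (inv \<sigma> x) = 0" using k by blast
  qed
  have "sum (k \<circ> \<sigma>) S = sum k (\<sigma> ` S)" for k :: "'a \<Rightarrow> nat"
    using sum.reindex[OF inj_on_subset[OF inj, of S], of k] by simp
  then show "(\<lambda>k. k \<circ> \<sigma>) ` compositions (\<sigma> ` S) m \<subseteq> compositions S m"
    using inj by (auto simp: compositions_def inj_image_mem_iff simp del: of_nat_sum)
qed

lemma coef_recolour:
  fixes \<sigma> :: "'c \<Rightarrow> 'c"
  assumes "bij \<sigma>"
  shows "coef (map (apfst \<sigma>) w) (a \<circ> inv \<sigma>) = coef w a"
proof (induction w arbitrary: a)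
  case (Cons x w)
  have [simp]: "inv \<sigma> (\<sigma> y) = y" for y using assms by (simp add: bij_is_inj)
  have im: "fst ` set (map (apfst \<sigma>) w) = \<sigma> ` fst ` set w" by force
  have "complete_shift (\<sigma> ` fst ` set w) m (coef (map (apfst \<sigma>) w)) (a \<circ> inv \<sigma>) = complete_shift (fst ` set w) m (coef w) a" for m
  proof -
    have "complete_shift (\<sigma> ` fst ` set w) m (coef (map (apfst \<sigma>) w)) (a \<circ> inv \<sigma>)
      = (\<Sum>k\<in>compositions (fst ` set w) m. coef (map (apfst \<sigma>) w) (\<lambda>x. (a \<circ> inv \<sigma>) x + int ((k \<circ> inv \<sigma>) x)))"
      unfolding complete_shift_def by (rule sum.reindex_bij_betw[symmetric, OF compositions_image[OF assms],
              where g = "\<lambda>k. coef (map (apfst \<sigma>) w) (\<lambda>x. (a \<circ> inv \<sigma>) x + int (k x))"]) simp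
    also have "\<dots> = (\<Sum>k\<in>compositions (fst ` set w) m. coef w (\<lambda>x. a x + int (k x)))"
      by (rule sum.cong[OF refl], subst Cons.IH[symmetric]) (simp add: o_def)
    finally show ?thesis unfolding complete_shift_def .
  qed
  then show ?case by (simp only: coef.simps list.map im) simp
qed simp

section \<open>Functionals on the module\<close>

definition linear_extension :: "('a \<Rightarrow> complex) \<Rightarrow> ('a \<Rightarrow>\<^sub>0 complex) \<Rightarrow> complex" where
  "linear_extension f x = (\<Sum>u\<in>Poly_Mapping.keys x. Poly_Mapping.lookup x u * f u)"

lemma linear_extension_superset:
  assumes "finite K" "Poly_Mapping.keys x \<subseteq> K"
  shows "linear_extension f x = (\<Sum>u\<in>K. Poly_Mapping.lookup x u * f u)"
  unfolding linear_extension_def using assms by (intro sum.mono_neutral_left) (auto simp: in_keys_iff)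

lemma linear_extension_add: "linear_extension f (x + y) = linear_extension f x + linear_extension f y"
proof -
  let ?K = "Poly_Mapping.keys x \<union> Poly_Mapping.keys y"
  have "Poly_Mapping.keys (x + y) \<subseteq> ?K" by (rule keys_add)
  then show ?thesis
    by (simp add: linear_extension_superset[of ?K] lookup_add distrib_right sum.distrib)
qed

lemma linear_extension_zero [simp]: "linear_extension f 0 = 0"
  by (simp add: linear_extension_def)

lemma linear_extension_diff: "linear_extension f (x - y) = linear_extension f x - linear_extension f y"
  using linear_extension_add[of f "x - y" y] by simp

lemma linear_extension_single [simp]: "linear_extension f (Poly_Mapping.single u c) = c * f u"
  by (cases "c = 0") (simp_all add: linear_extension_def)

lemma linear_extension_scale: "linear_extension f (scale_pm c x) = c * linear_extension f x"
  by (induction x rule: pm_induct) (simp_all add: pm.scale_right_distrib linear_extension_add distrib_left mult.assoc)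

text \<open>The exponent of the colour \<open>p\<close> is \<open>n - b p\<close> when \<open>b p \<ge> 1\<close>. Because the inner subtraction is
  truncated, it is at most \<open>n - 1\<close> for every \<open>b\<close>, so that every \<open>b\<close> gives a functional that respects
  the vacuum and therefore exists on the module. Words with a repeated colour, or of another length, are sent to zero.\<close>

definition word_value :: "('c::finite \<Rightarrow> nat) \<Rightarrow> ('c \<times> int) list \<Rightarrow> complex" where
  "word_value b ws = (if distinct (map fst ws) \<and> length ws = CARD('c)
     then coef ws (\<lambda>p. int CARD('c) - 1 - int (b p - 1)) else 0)"

lemma word_value_relation:
  fixes b :: "'c::finite \<Rightarrow> nat"
  shows
  "word_value b (u @ [(p, i), (q, j)] @ w) + word_value b (u @ [(q, j), (p, i)] @ w)
    = word_value b (u @ [(p, i + 1), (q, j - 1)] @ w) + word_value b (u @ [(q, j - 1), (p, i + 1)] @ w)"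
proof -
  let ?D = "distinct (map fst u @ [p, q] @ map fst w) \<and> length u + 2 + length w = CARD('c)"
  let ?a = "\<lambda>p. int CARD('c) - 1 - int (b p - 1)"
  have D: "distinct (map fst (u @ [x, y] @ w)) \<and> length (u @ [x, y] @ w) = CARD('c) \<longleftrightarrow> ?D"
    if "fst x = p \<and> fst y = q \<or> fst x = q \<and> fst y = p" for x y :: "'c \<times> int"
    using that by (elim disjE) (simp_all, blast+)
  have val: "word_value b (u @ [x, y] @ w) = (if ?D then coef (u @ [x, y] @ w) ?a else 0)"
    if "fst x = p \<and> fst y = q \<or> fst x = q \<and> fst y = p" for x y :: "'c \<times> int"
    unfolding word_value_def D[OF that] ..
  have "coef (u @ [(p, i), (q, j)] @ w) ?a + coef (u @ [(q, j), (p, i)] @ w) ?a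
    = coef (u @ [(p, i + 1), (q, j - 1)] @ w) ?a + coef (u @ [(q, j - 1), (p, i + 1)] @ w) ?a" if ?D
    by (rule coef_relation) (use that in simp)
  then show ?thesis by (subst (1 2 3 4) val) (auto simp del: append.simps)
qed

text \<open>The first letter contributes a complete symmetric polynomial of degree
  \<open>a p - (n - 1) - i\<close>, which is negative.\<close>

lemma word_value_pos:
  fixes b :: "'c::finite \<Rightarrow> nat"
  assumes "i > 0" shows "word_value b ((p, i) # w) = 0"
proof -
  have "complete_shift S (int CARD('c) - 1 - int (b p - 1) - int (length w) - i) g a = 0"
    if "Suc (length w) = CARD('c)" for S and g :: "('c \<Rightarrow> int) \<Rightarrow> complex" and a
    using assms unfolding that[symmetric] by (subst complete_shift_neg) simp_all
  then show ?thesis unfolding word_value_def by simp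
qed

lemma word_value_recolour:
  fixes \<sigma> :: "'c::finite \<Rightarrow> 'c"
  assumes "bij \<sigma>"
  shows "word_value (b \<circ> inv \<sigma>) (map (apfst \<sigma>) ws) = word_value b ws"
proof -
  have "map fst (map (apfst \<sigma>) ws) = map \<sigma> (map fst ws)" by simp
  then have "distinct (map fst (map (apfst \<sigma>) ws)) \<longleftrightarrow> distinct (map fst ws)"
    by (simp only: distinct_map inj_on_subset[OF bij_is_inj[OF assms] subset_UNIV] simp_thms)
  moreover have "(\<lambda>p. int CARD('c) - 1 - int ((b \<circ> inv \<sigma>) p - 1))
      = (\<lambda>p. int CARD('c) - 1 - int (b p - 1)) \<circ> inv \<sigma>" by auto
  ultimately show ?thesis
    unfolding word_value_def by (simp only: coef_recolour[OF assms] length_map)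
qed

lemma linear_extension_word_value_ideal: "x \<in> rel_ideal \<Longrightarrow> linear_extension (\<lambda>u. word_value b (letters u)) x = 0"
proof (induction rule: rel_ideal.induct)
  case (rel_gen x p i q j y)
  show ?case
  proof (induction x rule: pm_induct)
    case (single u c)
    show ?case
    proof (induction y rule: pm_induct)
      case (single w d)
      have "word_value b (letters u @ [(p, i), (q, j)] @ letters w) + word_value b (letters u @ [(q, j), (p, i)] @ letters w)
        - (word_value b (letters u @ [(p, i + 1), (q, j - 1)] @ letters w)
           + word_value b (letters u @ [(q, j - 1), (p, i + 1)] @ letters w)) = 0"
        unfolding word_value_relation[of b "letters u" p i q j "letters w"] by (rule diff_self)
      then have "c * d * (word_value b (letters u @ [(p, i), (q, j)] @ letters w) + word_value b (letters u @ [(q, j), (p, i)] @ letters w)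
        - (word_value b (letters u @ [(p, i + 1), (q, j - 1)] @ letters w)
           + word_value b (letters u @ [(q, j - 1), (p, i + 1)] @ letters w))) = 0"
        by (simp only: mult_zero_right)
      then show ?case
        by (simp add: anticomm_def free_gen_def mult_single distrib_left distrib_right
            left_diff_distrib right_diff_distrib linear_extension_add linear_extension_diff plus_fmon_def)
    qed (simp add: distrib_left linear_extension_add)
  qed (simp add: distrib_right linear_extension_add)
qed (simp_all add: linear_extension_add)

text \<open>The algebra is lifted only inside this context: later, lifting functions on pairs must leave
  their second components in the algebra.\<close>

context
  includes balg.lifting
  notes [transfer_rule] = balg.rel_eq_transfer zero_balg.transfer one_balg.transfer
    balg.bi_total plus_balg.transfer times_balg.transfer scale_balg.transfer gen.transfer
begin

lift_definition balg_value :: "('c::finite \<Rightarrow> nat) \<Rightarrow> 'c balg \<Rightarrow> complex"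
  is "\<lambda>b. linear_extension (\<lambda>u. word_value b (letters u))"
  unfolding balg_rel_def by (drule linear_extension_word_value_ideal) (simp add: linear_extension_diff)

lift_definition word :: "('c \<times> int) list \<Rightarrow> 'c balg" is "\<lambda>ws. pt (Fmon ws)" .

lemma balg_value_linear:
  "balg_value b (x + y) = balg_value b x + balg_value b y"
  "balg_value b (scale_balg c x) = c * balg_value b x"
  by (transfer; simp add: linear_extension_add linear_extension_scale)+

lemma balg_value_word: "balg_value b (word ws) = word_value b ws"
  by transfer simp

lemma balg_value_gen_pos: "i > 0 \<Longrightarrow> balg_value b (gen p i * x) = 0"
proof transfer
  fix i :: int and b :: "'a \<Rightarrow> nat" and p and x :: "('a \<times> int) free_alg"
  assume i: "i > 0"
  show "linear_extension (\<lambda>u. word_value b (letters u)) (free_gen p i * x) = 0"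
  proof (induction x rule: pm_induct)
    case (single u c)
    then show ?case by (simp add: free_gen_def mult_single plus_fmon_def word_value_pos[OF i])
  qed (simp add: distrib_left linear_extension_add)
qed

lemma word_Nil: "word [] = 1"
  by transfer (simp add: balg_rel_def rel_zero flip: single_one zero_fmon_def)

lemma word_single: "word [(p, i)] = gen p i"
  by transfer (simp add: balg_rel_def rel_zero free_gen_def)

lemma word_append: "word (u @ w) = word u * word w"
  by transfer (simp add: balg_rel_def rel_zero mult_single plus_fmon_def)

end

text \<open>This makes the functional on the algebra descend to the induced module. For a generator of
  the positive subalgebra both sides vanish, and the property passes to sums and products.\<close>

lemma balg_value_pos:
  "a \<in> balg_pos \<Longrightarrow> balg_value b (a * x) = augmentation a * balg_value b x"
proof (induction arbitrary: x rule: balg_pos.induct)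
  case (pos_mult a a')
  then show ?case by (simp add: mult.assoc augmentation_hom)
qed (simp_all add: augmentation_hom balg_value_gen_pos balg_value_linear distrib_left distrib_right scale_balg_mult mult.assoc)

lemma linear_extension_tensor_rels:
  assumes "t \<in> tensor_rels"
  shows "linear_extension (\<lambda>(m, x). m * balg_value b x) t = 0"
proof -
  consider (1) m m' y where "t = pt (m + m', y) - pt (m, y) - pt (m', y)"
    | (2) m y y' where "t = pt (m, y + y') - pt (m, y) - pt (m, y')"
    | (3) c m y where "t = pt (c * m, y) - scale_pm c (pt (m, y))"
    | (4) c m y where "t = pt (m, scale_balg c y) - scale_pm c (pt (m, y))"
    | (5) m a y where "a \<in> balg_pos" "t = pt (m * augmentation a, y) - pt (m, a * y)"
    using assms unfolding tensor_rels_def by blast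
  then show ?thesis
    by cases (simp_all add: linear_extension_diff linear_extension_scale balg_value_linear balg_value_pos distrib_left distrib_right)
qed

lift_definition fock_value :: "('c::finite \<Rightarrow> nat) \<Rightarrow> 'c fock \<Rightarrow> complex"
  is "\<lambda>b. linear_extension (\<lambda>(m, x). m * balg_value b x)"
proof -
  fix b :: "'c \<Rightarrow> nat" and x y :: "complex \<times> 'c balg \<Rightarrow>\<^sub>0 complex"
  let ?l = "linear_extension (\<lambda>(m, x). m * balg_value b x)"
  assume "fock_rel x y"
  then have "x - y \<in> pm.span tensor_rels" by (simp add: fock_rel_def)
  then have "?l (x - y) = 0"
    by (induction rule: pm.span_induct_alt) (simp_all add: linear_extension_add linear_extension_scale linear_extension_tensor_rels)
  then show "?l x = ?l y" by (simp add: linear_extension_diff)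
qed

lemma fock_value_linear:
  "fock_value b (x + y) = fock_value b x + fock_value b y"
  "fock_value b (scale_fock c x) = c * fock_value b x"
  by (transfer; simp add: linear_extension_add linear_extension_scale)+

lemma fock_value_tensor: "fock_value b (tensor m x) = m * balg_value b x"
  by transfer simp

lemma monomial_word: "monomial ws = tensor 1 (word ws)"
  unfolding monomial_def
  by (induction ws rule: rev_induct)
    (auto simp: vac_def word_Nil act_tensor word_append word_single)

lemma fock_value_monomial: "fock_value b (monomial ws) = word_value b ws"
  by (simp add: monomial_word fock_value_tensor balg_value_word)

text \<open>The rewriting rule used for straightening: the defining relation solved for one of its four
  products.\<close>

lemma monomial_exchange:
  "monomial (u @ [(p, i), (q, j)] @ w) = monomial (u @ [(p, i + 1), (q, j - 1)] @ w)
     + monomial (u @ [(q, j - 1), (p, i + 1)] @ w) - monomial (u @ [(q, j), (p, i)] @ w)"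
proof -
  have two: "word [x, y] = word [x] * word [y]" for x y :: "'a \<times> int"
    using word_append[of "[x]" "[y]"] by simp
  have "word [(p, i), (q, j)] + word [(q, j), (p, i)]
      = word [(p, i + 1), (q, j - 1)] + word [(q, j - 1), (p, i + 1)]"
    using gen_relation[of p i q j] by (simp add: two word_single anticomm_def)
  then have "word u * (word [(p, i), (q, j)] + word [(q, j), (p, i)]) * word w
      = word u * (word [(p, i + 1), (q, j - 1)] + word [(q, j - 1), (p, i + 1)]) * word w"
    by simp
  then have "word (u @ [(p, i), (q, j)] @ w) + word (u @ [(q, j), (p, i)] @ w)
      = word (u @ [(p, i + 1), (q, j - 1)] @ w) + word (u @ [(q, j - 1), (p, i + 1)] @ w)"
    by (simp only: word_append distrib_left distrib_right mult.assoc)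
  then have "tensor 1 (word (u @ [(p, i), (q, j)] @ w) + word (u @ [(q, j), (p, i)] @ w))
      = tensor 1 (word (u @ [(p, i + 1), (q, j - 1)] @ w) + word (u @ [(q, j - 1), (p, i + 1)] @ w))"
    by (simp only:)
  then show ?thesis
    by (simp only: tensor_bilinear monomial_word eq_diff_eq)
qed

lemma monomial_pos:
  assumes "i > 0" shows "monomial ((p, i) # w) = 0"
proof -
  have "monomial ((p, i) # w) = tensor 1 (gen p i * word w)"
    using word_append[of "[(p, i)]" w] by (simp add: monomial_word word_single)
  also have "\<dots> = tensor 0 (word w)"
    using tensor_balanced[OF pos_gen[OF assms, of p], of 1 "word w"] by (simp add: augmentation_hom)
  also have "\<dots> = 0" using tensor_bilinear(3)[of 0 0 "word w"] by simp
  finally show ?thesis .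
qed

section \<open>Straightening\<close>

definition colour_index :: "'n::finite \<Rightarrow> nat" where
  "colour_index = (SOME h. bij_betw h UNIV {0..<CARD('n)})"

lemma colour_index_bij: "bij_betw (colour_index :: 'n::finite \<Rightarrow> nat) UNIV {0..<CARD('n)}"
  unfolding colour_index_def using ex_bij_betw_finite_nat[OF finite] by (rule someI_ex)

lemma colour_index_less: "colour_index (p :: 'n::finite) < CARD('n)"
  using bij_betwE[OF colour_index_bij] by force

lemma colour_index_inj: "colour_index p = colour_index q \<longleftrightarrow> p = q"
  using bij_betw_imp_inj_on[OF colour_index_bij] by (auto dest: injD)

lemma lexicographic_less:
  fixes a b :: int
  assumes "int n * a + i < int n * b + j" "0 \<le> i" "j < int n"
  shows "a \<le> b"
proof (rule ccontr)
  assume "\<not> a \<le> b"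
  then have "int n * (b + 1) \<le> int n * a" by (intro mult_left_mono) auto
  then show False using assms by (simp add: distrib_left)
qed

text \<open>Comparing keys is comparing values of \<open>b\<close> first and the indices of the colours second.\<close>

definition colour_key :: "('n::finite \<Rightarrow> nat) \<Rightarrow> 'n \<Rightarrow> int" where
  "colour_key b p = int CARD('n) * int (b p) + int (colour_index p)"

lemma colour_key_less_imp_le: "colour_key b p < colour_key b q \<Longrightarrow> b p \<le> b q"
  for b :: "'n::finite \<Rightarrow> nat"
  using lexicographic_less[of "CARD('n)" "int (b p)" "int (colour_index p)" "int (b q)" "int (colour_index q)"]
    colour_index_less[of q] unfolding colour_key_def by simp

lemma inj_colour_key: "inj (colour_key b)"
proof (rule injI)
  fix p q :: 'a assume eq: "colour_key b p = colour_key b q"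
  have "colour_key b r mod int CARD('a) = int (colour_index r)" for r
    using colour_index_less[of r] unfolding colour_key_def by simp
  then have "int (colour_index p) = int (colour_index q)" using eq by metis
  then show "p = q" by (simp add: colour_index_inj)
qed

definition colour_order :: "('n::finite \<Rightarrow> nat) \<Rightarrow> 'n list" where
  "colour_order b = map (inv (colour_key b)) (sorted_list_of_set (range (colour_key b)))"

lemma map_colour_key_order: "map (colour_key b) (colour_order b) = sorted_list_of_set (range (colour_key b))"
  unfolding colour_order_def map_map
  by (rule map_idI) (auto simp: f_inv_into_f)

lemma colour_order_unique:
  assumes "sorted_wrt (<) (map (colour_key b) ps)" "set ps = UNIV"
  shows "ps = colour_order b"
proof -
  have "map (colour_key b) ps = sorted_list_of_set (range (colour_key b))"
    by (rule sorted_distinct_set_unique)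
      (use assms in \<open>auto simp: strict_sorted_iff\<close>)
  then have "map (inv (colour_key b)) (map (colour_key b) ps) = colour_order b"
    unfolding colour_order_def by simp
  then show ?thesis using inj_colour_key[of b] by (simp add: comp_def inv_f_f)
qed

lemma set_colour_order: "set (colour_order b) = UNIV"
proof -
  have "colour_key b ` set (colour_order b) = range (colour_key b)"
    using arg_cong[OF map_colour_key_order[of b], of set] by simp
  then show ?thesis using inj_colour_key[of b] by (simp add: inj_image_eq_iff)
qed

lemma length_colour_order: "length (colour_order (b :: 'n::finite \<Rightarrow> nat)) = CARD('n)"
  unfolding colour_order_def using inj_colour_key[of b] by (simp add: card_image)

lemma distinct_colour_order: "distinct (colour_order b)"
  using map_colour_key_order[of b]
  by (metis distinct_map sorted_list_of_set.distinct_sorted_key_list_of_set)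

lemma colour_order_mono:
  assumes "s \<le> t" "t < CARD('n)"
  shows "(b :: 'n::finite \<Rightarrow> nat) (colour_order b ! s) \<le> b (colour_order b ! t)"
proof (cases "s = t")
  case False
  have "sorted_wrt (<) (map (colour_key b) (colour_order b))"
    unfolding map_colour_key_order by simp
  then have "colour_key b (colour_order b ! s) < colour_key b (colour_order b ! t)"
    using False assms by (simp add: sorted_wrt_iff_nth_less length_colour_order)
  then show ?thesis by (rule colour_key_less_imp_le)
qed simp

text \<open>List positions start at zero, hence the successor.\<close>

definition normal_word :: "('n::finite \<Rightarrow> nat) \<Rightarrow> ('n \<times> int) list" where
  "normal_word b = map (\<lambda>s. (colour_order b ! s, int (Suc s) - int (b (colour_order b ! s)))) [0..<CARD('n)]"

definition multi_word :: "('n::finite \<times> int) list \<Rightarrow> bool" where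
  "multi_word ws \<longleftrightarrow> length ws = CARD('n) \<and> distinct (map fst ws) \<and> (\<forall>x\<in>set ws. snd x \<ge> 0)"

lemma map_fst_normal_word: "map fst (normal_word b) = colour_order b"
  by (rule nth_equalityI) (simp_all add: normal_word_def length_colour_order)

text \<open>If the value at position \<open>s\<close> exceeded \<open>s + 1\<close>, then only the \<open>s\<close> colours before it could have
  values up to \<open>s + 1\<close>, one fewer than the parking condition demands.\<close>

lemma parking_colour_order:
  fixes b :: "'n::finite \<Rightarrow> nat"
  assumes "b \<in> parking_functions" "s < CARD('n)"
  shows "b (colour_order b ! s) \<le> Suc s"
proof (rule ccontr)
  assume "\<not> b (colour_order b ! s) \<le> Suc s"
  then have "b (colour_order b ! t) > Suc s" if "s \<le> t" "t < CARD('n)" for t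
    using colour_order_mono[OF that, of b] by simp
  have "b -` {1..Suc s} \<subseteq> (\<lambda>t. colour_order b ! t) ` {..<s}"
  proof
    fix p assume p: "p \<in> b -` {1..Suc s}"
    obtain t where t: "t < CARD('n)" "colour_order b ! t = p"
      using set_colour_order[of b] by (metis UNIV_I in_set_conv_nth length_colour_order)
    then have "t < s"
      using p \<open>\<And>t. \<lbrakk>s \<le> t; t < CARD('n)\<rbrakk> \<Longrightarrow> Suc s < b (colour_order b ! t)\<close>[of t] by force
    with t show "p \<in> (\<lambda>t. colour_order b ! t) ` {..<s}" by blast
  qed
  then have "card (b -` {1..Suc s}) \<le> s"
    using card_mono[of "(\<lambda>t. colour_order b ! t) ` {..<s}" "b -` {1..Suc s}"] card_image_le[of "{..<s}" "\<lambda>t. colour_order b ! t"]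
    by simp
  moreover have "card (b -` {1..Suc s}) \<ge> Suc s"
    using assms by (auto simp: parking_functions_def)
  ultimately show False by simp
qed

lemma multi_word_normal_word:
  assumes "b \<in> parking_functions"
  shows "multi_word (normal_word b)"
  unfolding multi_word_def map_fst_normal_word
proof (intro conjI ballI)
  fix x assume "x \<in> set (normal_word b)"
  then obtain s where "s < CARD('a)" "snd x = int (Suc s) - int (b (colour_order b ! s))"
    by (auto simp: normal_word_def)
  then show "snd x \<ge> 0" using parking_colour_order[OF assms, of s] by linarith
qed (simp_all add: normal_word_def distinct_colour_order)

text \<open>At position \<open>s\<close> (counted from zero) of a normal word, \<open>colour_key b p = n (s + 2) - weight\<close>, so
  that increasing keys mean that the weight grows by less than \<open>n\<close> from each letter to the next.
  The exponent is raised by one in order to make weights of nonnegative exponents positive.\<close>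

definition weight :: "'n::finite \<times> int \<Rightarrow> int" where
  "weight x = int CARD('n) * (snd x + 1) - int (colour_index (fst x))"

text \<open>The sum of the weights over all proper tails, that is \<open>\<Sum>\<^sub>s s weight\<^sub>s\<close> with positions \<open>s\<close>
  counted from zero. It drops when weight moves to the left, and it makes the straightening
  terminate.\<close>

primrec potential :: "('n::finite \<times> int) list \<Rightarrow> int" where
  "potential [] = 0"
| "potential (x # xs) = sum_list (map weight xs) + potential xs"

lemma potential_exchange:
  assumes "weight x' + weight y' = weight x + weight y" "weight y' < weight y"
  shows "potential (u @ [x', y'] @ w) < potential (u @ [x, y] @ w)"
  by (induction u) (use assms in auto)

lemma weight_pos: "snd x \<ge> 0 \<Longrightarrow> weight (x :: 'n::finite \<times> int) > 0"
proof -
  assume "snd x \<ge> 0"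
  then have "int CARD('n) * 1 \<le> int CARD('n) * (snd x + 1)" by (intro mult_left_mono) auto
  then show ?thesis using colour_index_less[of "fst x"] unfolding weight_def by linarith
qed

lemma potential_nonneg: "\<forall>x\<in>set ws. snd x \<ge> 0 \<Longrightarrow> potential ws \<ge> 0"
proof (induction ws)
  case (Cons x ws)
  moreover have "sum_list (map weight ws) \<ge> 0"
    using Cons.prems weight_pos by (intro sum_list_nonneg) (auto intro: less_imp_le)
  ultimately show ?case by simp
qed simp

lemma weight_gap_imp_less:
  fixes p q :: "'n::finite"
  assumes "weight (q, j) \<ge> weight (p, i) + int CARD('n)"
  shows "i < j"
proof (rule ccontr)
  assume "\<not> i < j"
  then have "int CARD('n) * (j + 1) \<le> int CARD('n) * (i + 1)" by (intro mult_left_mono) auto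
  then show False
    using assms colour_index_less[of p] unfolding weight_def fst_conv snd_conv by linarith
qed

text \<open>If no rewriting step applies, then \<open>b p\<^sub>s = s - i\<^sub>s\<close> (positions \<open>s\<close> counted from one) defines a
  function whose keys increase along the word. It starts with the value \<open>1\<close> and
  never exceeds the position, hence it is parking and the word is its normal word.\<close>

lemma irreducible_word_normal:
  fixes ws :: "('n::finite \<times> int) list"
  assumes word: "multi_word ws" and hd: "snd (ws ! 0) = 0"
    and irred: "\<And>s. Suc s < length ws \<Longrightarrow> weight (ws ! Suc s) < weight (ws ! s) + int CARD('n)"
  shows "\<exists>b\<in>parking_functions. ws = normal_word b"
proof -
  let ?n = "CARD('n)"
  have len: "length ws = ?n" and dist: "distinct (map fst ws)"
    and nonneg: "\<And>s. s < ?n \<Longrightarrow> snd (ws ! s) \<ge> 0"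
    using word by (auto simp: multi_word_def)
  \<comment> \<open>\<open>c s\<close> will be the value of \<open>b\<close> at the \<open>s\<close>-th colour, and \<open>k s\<close> its key; positions start at zero\<close>
  define c where "c s = int (Suc s) - snd (ws ! s)" for s
  define k where "k s = int ?n * c s + int (colour_index (fst (ws ! s)))" for s
  have k_weight: "k s = int ?n * (int s + 2) - weight (ws ! s)" for s
    by (simp add: k_def c_def weight_def algebra_simps)
  have k_Suc: "k s < k (Suc s)" if "Suc s < ?n" for s
    using irred[of s] that len by (simp add: k_weight algebra_simps)
  have k_mono: "k s < k t" if "s < t" "t < ?n" for s t
    using that
  proof (induction t)
    case (Suc t)
    then show ?case using k_Suc[of t] by (cases "s = t") auto
  qed simp
  have c_pos: "c s \<ge> 1" if "s < ?n" for s
  proof (cases "s = 0")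
    case False
    then have "k 0 < k s" using k_mono that by simp
    then have "c 0 \<le> c s"
      unfolding k_def using lexicographic_less[of ?n "c 0" _ "c s"] colour_index_less[of "fst (ws ! s)"] by simp
    then show ?thesis using hd by (simp add: c_def)
  qed (use hd in \<open>simp add: c_def\<close>)
  have set_fst: "set (map fst ws) = UNIV"
    using dist len by (intro card_subset_eq) (simp_all add: distinct_card[of "map fst ws"] del: set_map)
  have bij: "bij_betw (\<lambda>s. fst (ws ! s)) {..<?n} UNIV"
  proof (subst bij_betw_cong)
    show "fst (ws ! s) = map fst ws ! s" if "s \<in> {..<?n}" for s using that len by simp
    show "bij_betw ((!) (map fst ws)) {..<?n} UNIV"
      using bij_betw_nth[OF dist refl set_fst[symmetric]] len by simp
  qed
  define b where "b p = nat (c (inv_into {..<?n} (\<lambda>s. fst (ws ! s)) p))" for p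
  have b_nth: "int (b (fst (ws ! s))) = c s" if "s < ?n" for s
  proof -
    have "inv_into {..<?n} (\<lambda>s. fst (ws ! s)) (fst (ws ! s)) = s"
      by (rule bij_betw_inv_into_left[OF bij]) (use that in simp)
    with c_pos[OF that] show ?thesis unfolding b_def by (simp only: int_nat_eq) simp
  qed
  have key: "colour_key b (fst (ws ! s)) = k s" if "s < ?n" for s
    using b_nth[OF that] by (simp add: colour_key_def k_def)
  have order: "map fst ws = colour_order b"
    by (rule colour_order_unique) (use k_mono key len set_fst in \<open>auto simp: sorted_wrt_iff_nth_less\<close>)
  have "ws = normal_word b"
  proof (rule nth_equalityI)
    fix s assume s: "s < length ws"
    then have "colour_order b ! s = fst (ws ! s)" by (simp flip: order)
    then show "ws ! s = normal_word b ! s"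
      using b_nth[of s] s len by (simp add: normal_word_def c_def prod_eq_iff)
  qed (simp add: normal_word_def len)
  moreover have "b \<in> parking_functions"
  proof -
    have b_le: "1 \<le> b (fst (ws ! s)) \<and> b (fst (ws ! s)) \<le> Suc s" if "s < ?n" for s
      using b_nth[OF that] c_pos[OF that] nonneg[OF that] by (auto simp: c_def)
    have "b p \<in> {1..?n}" for p
    proof -
      have "p \<in> (\<lambda>s. fst (ws ! s)) ` {..<?n}" by (simp only: bij_betw_imp_surj_on[OF bij] UNIV_I)
      then obtain s where "s < ?n" "p = fst (ws ! s)" by blast
      then show ?thesis using b_le[of s] by simp
    qed
    moreover have "card (b -` {1..j}) \<ge> j" if "j \<le> ?n" for j
    proof -
      have "(\<lambda>s. fst (ws ! s)) ` {..<j} \<subseteq> b -` {1..j}"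
      proof (intro image_subsetI)
        fix s assume "s \<in> {..<j}"
        then show "fst (ws ! s) \<in> b -` {1..j}" using b_le[of s] that by simp
      qed
      then have "card ((\<lambda>s. fst (ws ! s)) ` {..<j}) \<le> card (b -` {1..j})"
        by (rule card_mono[OF finite])
      moreover have "inj_on (\<lambda>s. fst (ws ! s)) {..<j}"
        by (rule inj_on_subset[OF bij_betw_imp_inj_on[OF bij]]) (use that in auto)
      ultimately show ?thesis by (simp add: card_image)
    qed
    ultimately show ?thesis by (simp add: parking_functions_def image_subset_iff)
  qed
  ultimately show ?thesis by blast
qed

text \<open>Induction on the potential. If the weight grows by at least \<open>n\<close> between two neighbouring letters,
  the exchange relation replaces them by three pairs with the same total weight but a lighter
  second letter. The growth is never exactly \<open>n\<close>, because the colours differ. If it is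
  less than \<open>n\<close> everywhere, the word is normal unless its first exponent is
  positive, in which case the vacuum kills it.\<close>

lemma monomial_in_span_normal:
  fixes ws :: "('n::finite \<times> int) list"
  assumes "multi_word ws"
  shows "monomial ws \<in> fock.span (monomial ` normal_word ` parking_functions)"
  using assms
proof (induction "nat (potential ws)" arbitrary: ws rule: less_induct)
  case less
  let ?V = "fock.span (monomial ` normal_word ` (parking_functions :: ('n \<Rightarrow> nat) set))"
  show ?case
  proof (cases "\<exists>s. Suc s < length ws \<and> weight (ws ! Suc s) \<ge> weight (ws ! s) + int CARD('n)")
    case True
    then obtain s where s: "Suc s < length ws" "weight (ws ! Suc s) \<ge> weight (ws ! s) + int CARD('n)"
      by blast
    obtain p i q j where pq: "ws ! s = (p, i)" "ws ! Suc s = (q, j)" by fastforce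
    define u w where "u = take s ws" and "w = drop (Suc (Suc s)) ws"
    have ws: "ws = u @ [(p, i), (q, j)] @ w"
      using s(1) pq unfolding u_def w_def by (simp add: Cons_nth_drop_Suc flip: pq)
    have gap: "weight (q, j) \<ge> weight (p, i) + int CARD('n)" using s(2) pq by simp
    have "i < j" using gap by (rule weight_gap_imp_less)
    have "p \<noteq> q" and "i \<ge> 0" using less.prems unfolding ws by (auto simp: multi_word_def)
    have "weight (q, j) \<noteq> weight (p, i) + int CARD('n)"
    proof
      assume "weight (q, j) = weight (p, i) + int CARD('n)"
      then have "int CARD('n) * (j - i - 1) = int (colour_index q) - int (colour_index p)"
        by (simp add: weight_def algebra_simps)
      moreover have "\<bar>int (colour_index q) - int (colour_index p)\<bar> < int CARD('n)"
        using colour_index_less[of p] colour_index_less[of q] by auto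
      moreover have "int CARD('n) dvd int (colour_index q) - int (colour_index p)"
        using calculation(1) by (metis dvd_triv_left)
      ultimately have "int (colour_index q) - int (colour_index p) = 0"
        using dvd_imp_le_int[of "int (colour_index q) - int (colour_index p)" "int CARD('n)"] by fastforce
      then show False using \<open>p \<noteq> q\<close> by (simp add: colour_index_inj)
    qed
    with gap have gap': "weight (q, j) > weight (p, i) + int CARD('n)" by simp
    have weight_Suc: "weight (r, m + 1) = weight (r, m) + int CARD('n)"
      "weight (r, m - 1) = weight (r, m) - int CARD('n)" for r :: 'n and m
      by (simp_all add: weight_def algebra_simps)
    have smaller: "monomial (u @ [x, y] @ w) \<in> ?V"
      if "weight x + weight y = weight (p, i) + weight (q, j)" "weight y < weight (q, j)"
        "{fst x, fst y} = {p, q}" "snd x \<ge> 0" "snd y \<ge> 0" for x y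
    proof (rule less.hyps)
      have "\<forall>z\<in>set (u @ [x, y] @ w). snd z \<ge> 0"
        using less.prems that unfolding ws multi_word_def by auto
      moreover from this have "potential (u @ [x, y] @ w) \<ge> 0" by (rule potential_nonneg)
      moreover have "potential (u @ [x, y] @ w) < potential ws"
        unfolding ws using that by (intro potential_exchange) simp_all
      moreover have "fst x = p \<and> fst y = q \<or> fst x = q \<and> fst y = p"
        using that(3) by (auto simp: doubleton_eq_iff)
      ultimately show "nat (potential (u @ [x, y] @ w)) < nat (potential ws)" "multi_word (u @ [x, y] @ w)"
        using less.prems unfolding ws multi_word_def by auto
    qed
    have "monomial (u @ [(p, i + 1), (q, j - 1)] @ w) \<in> ?V"
      by (rule smaller) (use \<open>i < j\<close> \<open>i \<ge> 0\<close> gap' in \<open>auto simp: weight_Suc\<close>)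
    moreover have "monomial (u @ [(q, j - 1), (p, i + 1)] @ w) \<in> ?V"
      by (rule smaller) (use \<open>i < j\<close> \<open>i \<ge> 0\<close> gap' in \<open>auto simp: weight_Suc\<close>)
    moreover have "monomial (u @ [(q, j), (p, i)] @ w) \<in> ?V"
      by (rule smaller) (use \<open>i < j\<close> \<open>i \<ge> 0\<close> gap' in auto)
    ultimately show ?thesis
      unfolding ws monomial_exchange[of u p i q j w] by (intro fock.span_diff fock.span_add)
  next
    case False
    then have irred: "weight (ws ! Suc s) < weight (ws ! s) + int CARD('n)" if "Suc s < length ws" for s
      using that by force
    obtain p i w where ws: "ws = (p, i) # w"
      using less.prems by (cases ws) (auto simp: multi_word_def)
    show ?thesis
    proof (cases "i > 0")
      case True
      then show ?thesis unfolding ws by (simp only: monomial_pos fock.span_zero)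
    next
      case False
      then have "snd (ws ! 0) = 0" using less.prems unfolding ws by (auto simp: multi_word_def)
      then obtain b where "b \<in> parking_functions" "ws = normal_word b"
        using irreducible_word_normal[OF less.prems _ irred] by blast
      then show ?thesis by (auto intro: fock.span_base)
    qed
  qed
qed

section \<open>Counting parking functions\<close>

definition num_below :: "('n::finite \<Rightarrow> nat) \<Rightarrow> nat \<Rightarrow> nat" where
  "num_below g v = card {x. g x < v}"

text \<open>Rotating the circle with the spots \<open>0, \<dots>, n\<close> so that spot \<open>c\<close> becomes spot \<open>0\<close>.\<close>

definition rotate_fun :: "nat \<Rightarrow> nat \<Rightarrow> ('n \<Rightarrow> nat) \<Rightarrow> 'n \<Rightarrow> nat" where
  "rotate_fun n c g x = (if c \<le> g x then g x - c else g x + (n + 1) - c)"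

lemma num_below_rotate_le:
  assumes "c + j \<le> n + 1" "range g \<subseteq> {0..n}"
  shows "num_below (rotate_fun n c g) j + num_below g c = num_below g (c + j)"
proof -
  have "{x. g x < c + j} = {x. rotate_fun n c g x < j} \<union> {x. g x < c}"
    using assms by (auto simp: rotate_fun_def image_subset_iff split: if_splits)
  moreover have "{x. rotate_fun n c g x < j} \<inter> {x. g x < c} = {}"
    using assms by (auto simp: rotate_fun_def image_subset_iff)
  ultimately show ?thesis unfolding num_below_def by (simp add: card_Un_disjoint)
qed

lemma num_below_rotate_gt:
  fixes g :: "'n::finite \<Rightarrow> nat"
  assumes "c + j = w + (n + 1)" "c \<le> n" "j \<le> n" "range g \<subseteq> {0..n}"
  shows "num_below (rotate_fun n c g) j + num_below g c = CARD('n) + num_below g w"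
proof -
  have "{x. rotate_fun n c g x < j} = {x. g x < w} \<union> {x. c \<le> g x}"
  proof (intro set_eqI)
    fix x
    have "g x \<le> n" using assms(4) by (auto simp: image_subset_iff)
    then show "x \<in> {x. rotate_fun n c g x < j} \<longleftrightarrow> x \<in> {x. g x < w} \<union> {x. c \<le> g x}"
      using assms(1-3) by (auto simp: rotate_fun_def)
  qed
  moreover have "{x. g x < w} \<inter> {x. c \<le> g x} = {}"
    using assms by auto
  ultimately have "num_below (rotate_fun n c g) j = num_below g w + card {x. c \<le> g x}"
    unfolding num_below_def by (simp add: card_Un_disjoint)
  moreover have "card {x. c \<le> g x} + num_below g c = CARD('n)"
  proof -
    have "{x. c \<le> g x} \<inter> {x. g x < c} = {}" "{x. c \<le> g x} \<union> {x. g x < c} = UNIV" by auto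
    then show ?thesis unfolding num_below_def by (metis card_Un_disjoint finite)
  qed
  ultimately show ?thesis by simp
qed

text \<open>Let \<open>S v = num_below g v - v\<close>, the walk with steps (number of cars at a spot) minus one. On
  the circle it loses one per turn, so the rotated function is parking exactly if \<open>S\<close> attains its
  minimum over \<open>{0..n}\<close> at \<open>c\<close>, and at \<open>c\<close> for the first time.\<close>

lemma rotate_parking_iff:
  fixes g :: "'n::finite \<Rightarrow> nat"
  defines "n \<equiv> CARD('n)"
  assumes "range g \<subseteq> {0..n}" "c \<le> n"
  shows "(\<forall>j\<in>{1..n}. num_below (rotate_fun n c g) j \<ge> j) \<longleftrightarrow>
    (\<forall>v<c. int (num_below g c) - int c < int (num_below g v) - int v) \<and>
    (\<forall>v\<in>{c<..n}. int (num_below g c) - int c \<le> int (num_below g v) - int v)"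
    (is "?L \<longleftrightarrow> ?R1 \<and> ?R2")
proof (intro iffI conjI allI ballI impI)
  fix v assume L: ?L and "v < c"
  then have "v + (n + 1) - c \<in> {1..n}" using assms(3) by auto
  with L have "num_below (rotate_fun n c g) (v + (n + 1) - c) \<ge> v + (n + 1) - c" by blast
  with num_below_rotate_gt[of c "v + (n + 1) - c" v n g] \<open>v < c\<close> assms
  show "int (num_below g c) - int c < int (num_below g v) - int v" by auto
next
  fix v assume L: ?L and "v \<in> {c<..n}"
  then have "v - c \<in> {1..n}" by auto
  with L have "num_below (rotate_fun n c g) (v - c) \<ge> v - c" by blast
  with num_below_rotate_le[of c "v - c" n g] \<open>v \<in> {c<..n}\<close> assms
  show "int (num_below g c) - int c \<le> int (num_below g v) - int v" by auto
next
  fix j assume R: "?R1 \<and> ?R2" and j: "j \<in> {1..n}"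
  show "j \<le> num_below (rotate_fun n c g) j"
  proof (cases "c + j \<le> n")
    case True
    then have "c + j \<in> {c<..n}" using j by auto
    with R have "int (num_below g c) - int c \<le> int (num_below g (c + j)) - int (c + j)" by blast
    with num_below_rotate_le[of c j n g] True assms show ?thesis by auto
  next
    case False
    define w where "w = c + j - (n + 1)"
    have w: "w < c" "c + j = w + (n + 1)" using False j assms by (auto simp: w_def)
    then have "int (num_below g c) - int c < int (num_below g w) - int w" using R by auto
    with num_below_rotate_gt[of c j w n g] w j assms show ?thesis by auto
  qed
qed

lemma ex1_first_minimum:
  fixes S :: "nat \<Rightarrow> int"
  shows "\<exists>!c. c \<le> n \<and> (\<forall>v<c. S c < S v) \<and> (\<forall>v\<in>{c<..n}. S c \<le> S v)"
proof -
  define P where "P c \<longleftrightarrow> c \<le> n \<and> (\<forall>v\<le>n. S c \<le> S v)" for c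
  have "\<exists>c. P c"
  proof -
    have "Min (S ` {..n}) \<in> S ` {..n}" by (intro Min_in) auto
    then obtain c where "c \<le> n" "S c = Min (S ` {..n})" by fastforce
    then have "P c" unfolding P_def by (auto simp: Min_le)
    then show ?thesis ..
  qed
  then have P: "P (LEAST c. P c)" by (metis LeastI)
  let ?c = "LEAST c. P c"
  show ?thesis
  proof (rule ex1I[of _ ?c])
    show "?c \<le> n \<and> (\<forall>v<?c. S ?c < S v) \<and> (\<forall>v\<in>{?c<..n}. S ?c \<le> S v)"
    proof (intro conjI allI impI ballI)
      show "?c \<le> n" using P by (simp add: P_def)
      fix v assume v: "v < ?c"
      then have "\<not> P v" using not_less_Least by blast
      moreover have "v \<le> n" using P v by (simp add: P_def)
      ultimately obtain u where "u \<le> n" "S u < S v" by (auto simp: P_def not_le)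
      moreover have "S ?c \<le> S u" using P \<open>u \<le> n\<close> by (simp add: P_def)
      ultimately show "S ?c < S v" by simp
    next
      fix v assume "v \<in> {?c<..n}"
      then show "S ?c \<le> S v" using P by (simp add: P_def)
    qed
    fix c assume c: "c \<le> n \<and> (\<forall>v<c. S c < S v) \<and> (\<forall>v\<in>{c<..n}. S c \<le> S v)"
    have "P c" unfolding P_def
    proof (intro conjI allI impI)
      fix v assume "v \<le> n"
      then show "S c \<le> S v" using c by (cases v c rule: linorder_cases) auto
    qed (use c in simp)
    then have "?c \<le> c" by (rule Least_le)
    moreover have "\<not> ?c < c"
    proof
      assume "?c < c"
      then have "S c < S ?c" using c by blast
      moreover have "S ?c \<le> S c" using P c by (simp add: P_def)
      ultimately show False by simp
    qed
    ultimately show "c = ?c" by simp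
  qed
qed

lemma card_functions_nat_le:
  "card {g :: 'n::finite \<Rightarrow> nat. range g \<subseteq> {0..m}} = (m + 1) ^ CARD('n)"
proof -
  have "{g :: 'n \<Rightarrow> nat. range g \<subseteq> {0..m}} = PiE UNIV (\<lambda>_. {0..m})"
    by (auto simp: PiE_UNIV_domain)
  then show ?thesis by (simp add: card_PiE)
qed

lemma rotate_fun_range:
  "rotate_fun n c ` {g. range g \<subseteq> {0..n}} \<subseteq> {g. range g \<subseteq> {0..n}}"
proof clarify
  fix g :: "'a \<Rightarrow> nat" and x assume "range g \<subseteq> {0..n}"
  then have "g x \<le> n" by (auto simp: image_subset_iff)
  then show "rotate_fun n c g x \<in> {0..n}" by (auto simp: rotate_fun_def)
qed

lemma bij_betw_rotate_fun:
  assumes "c \<le> n"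
  shows "bij_betw (rotate_fun n c) {g. range g \<subseteq> {0..n}} {g. range g \<subseteq> {0..n}}"
proof (rule bij_betw_byWitness[where f' = "rotate_fun n (if c = 0 then 0 else n + 1 - c)"])
  let ?G = "{g :: 'a \<Rightarrow> nat. range g \<subseteq> {0..n}}"
  show "\<forall>g\<in>?G. rotate_fun n (if c = 0 then 0 else n + 1 - c) (rotate_fun n c g) = g"
  proof (intro ballI ext)
    fix g :: "'a \<Rightarrow> nat" and x assume "g \<in> ?G"
    then have "g x \<le> n" by (auto simp: image_subset_iff)
    then show "rotate_fun n (if c = 0 then 0 else n + 1 - c) (rotate_fun n c g) x = g x"
      using assms by (auto simp: rotate_fun_def)
  qed
  show "\<forall>g\<in>?G. rotate_fun n c (rotate_fun n (if c = 0 then 0 else n + 1 - c) g) = g"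
  proof (intro ballI ext)
    fix g :: "'a \<Rightarrow> nat" and x assume "g \<in> ?G"
    then have "g x \<le> n" by (auto simp: image_subset_iff)
    then show "rotate_fun n c (rotate_fun n (if c = 0 then 0 else n + 1 - c) g) x = g x"
      using assms by (auto simp: rotate_fun_def)
  qed
  show "rotate_fun n c ` ?G \<subseteq> ?G" by (rule rotate_fun_range)
  show "rotate_fun n (if c = 0 then 0 else n + 1 - c) ` ?G \<subseteq> ?G" by (rule rotate_fun_range)
qed

text \<open>On the circle, values start from zero and the extra spot \<open>n\<close> is admitted; the parking
  condition for \<open>j = n\<close> excludes that spot again.\<close>

lemma parking_functions_Suc:
  "parking_functions = (\<lambda>g. Suc \<circ> g) ` {g :: 'n::finite \<Rightarrow> nat.
      range g \<subseteq> {0..CARD('n)} \<and> (\<forall>j\<in>{1..CARD('n)}. num_below g j \<ge> j)}"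
    (is "_ = _ ` ?P")
proof (rule set_eqI, rule iffI)
  fix b :: "'n \<Rightarrow> nat" assume "b \<in> parking_functions"
  then have r: "b x \<in> {1..CARD('n)}" and k: "j \<in> {1..CARD('n)} \<Longrightarrow> card (b -` {1..j}) \<ge> j" for x j
    by (auto simp: parking_functions_def image_subset_iff)
  have pos: "b x > 0" and le: "b x - 1 \<le> CARD('n)" for x using r[of x] by auto
  have "x \<in> b -` {1..j} \<longleftrightarrow> b x - 1 < j" for x j
    using pos[of x] by auto
  then have "b -` {1..j} = {x. b x - 1 < j}" for j by blast
  with k have "\<forall>j\<in>{1..CARD('n)}. num_below (\<lambda>x. b x - 1) j \<ge> j"
    unfolding num_below_def by simp
  then have "(\<lambda>x. b x - 1) \<in> ?P" using le by (simp add: image_subset_iff)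
  moreover have "b = Suc \<circ> (\<lambda>x. b x - 1)" using pos by (auto simp: fun_eq_iff)
  ultimately show "b \<in> (\<lambda>g. Suc \<circ> g) ` ?P" by blast
next
  fix b assume "b \<in> (\<lambda>g. Suc \<circ> g) ` ?P"
  then obtain g where g: "g \<in> ?P" and b: "b = Suc \<circ> g" by blast
  have "0 < CARD('n)" by simp
  then have "CARD('n) \<in> {1..CARD('n)}" by (metis One_nat_def Suc_leI atLeastAtMost_iff order_refl)
  then have "num_below g CARD('n) \<ge> CARD('n)" using g by blast
  then have "{x. g x < CARD('n)} = UNIV" unfolding num_below_def by (intro card_seteq) auto
  then have "g x < CARD('n)" for x by blast
  then have "range b \<subseteq> {1..CARD('n)}" unfolding b by (auto simp: Suc_le_eq)
  moreover have "b -` {1..j} = {x. g x < j}" for j unfolding b by auto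
  ultimately show "b \<in> parking_functions"
    using g by (auto simp: parking_functions_def num_below_def)
qed

text \<open>Counting the pairs of a function on the circle and a rotation that makes it parking in two
  ways.\<close>

lemma card_parking_functions:
  "card (parking_functions :: ('n::finite \<Rightarrow> nat) set) = (CARD('n) + 1) ^ (CARD('n) - 1)"
proof -
  let ?n = "CARD('n)"
  let ?G = "{g :: 'n \<Rightarrow> nat. range g \<subseteq> {0..?n}}"
  let ?P = "{g \<in> ?G. \<forall>j\<in>{1..?n}. num_below g j \<ge> j}"
  have finG: "finite ?G"
    using card_functions_nat_le[of ?n, where 'n = 'n] by (intro card_ge_0_finite) simp
  have unique: "card {c \<in> {0..?n}. rotate_fun ?n c g \<in> ?P} = 1" if "g \<in> ?G" for g
  proof -
    have iff: "rotate_fun ?n c g \<in> ?P \<longleftrightarrow> (\<forall>v<c. int (num_below g c) - int c < int (num_below g v) - int v) \<and>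
        (\<forall>v\<in>{c<..?n}. int (num_below g c) - int c \<le> int (num_below g v) - int v)" if "c \<le> ?n" for c
    proof -
      have "rotate_fun ?n c g \<in> ?G" using \<open>g \<in> ?G\<close> rotate_fun_range by blast
      then show ?thesis using \<open>g \<in> ?G\<close> rotate_parking_iff[of g c] that by simp
    qed
    have "{c \<in> {0..?n}. rotate_fun ?n c g \<in> ?P} = {c. c \<le> ?n \<and> (\<forall>v<c. int (num_below g c) - int c < int (num_below g v) - int v) \<and>
        (\<forall>v\<in>{c<..?n}. int (num_below g c) - int c \<le> int (num_below g v) - int v)}"
    proof (intro Collect_cong conj_cong)
      fix c assume "c \<le> ?n"
      then show "rotate_fun ?n c g \<in> ?P \<longleftrightarrow> (\<forall>v<c. int (num_below g c) - int c < int (num_below g v) - int v) \<and>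
        (\<forall>v\<in>{c<..?n}. int (num_below g c) - int c \<le> int (num_below g v) - int v)" by (rule iff)
    qed simp
    moreover obtain c where "{c. c \<le> ?n \<and> (\<forall>v<c. int (num_below g c) - int c < int (num_below g v) - int v) \<and>
        (\<forall>v\<in>{c<..?n}. int (num_below g c) - int c \<le> int (num_below g v) - int v)} = {c}"
      using ex1_first_minimum[of ?n "\<lambda>v. int (num_below g v) - int v"] by (auto elim!: ex1E)
    ultimately show ?thesis by simp
  qed
  have per_shift: "card {g \<in> ?G. rotate_fun ?n c g \<in> ?P} = card ?P" if "c \<in> {0..?n}" for c
  proof -
    have b: "bij_betw (rotate_fun ?n c) ?G ?G" using that by (intro bij_betw_rotate_fun) simp
    have image: "rotate_fun ?n c ` {g \<in> ?G. rotate_fun ?n c g \<in> ?P} = ?P"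
    proof (intro set_eqI iffI)
      fix h assume h: "h \<in> ?P"
      then have "h \<in> ?G" by blast
      then obtain g where "g \<in> ?G" "h = rotate_fun ?n c g" using b unfolding bij_betw_def by blast
      with h show "h \<in> rotate_fun ?n c ` {g \<in> ?G. rotate_fun ?n c g \<in> ?P}" by blast
    next
      fix h assume "h \<in> rotate_fun ?n c ` {g \<in> ?G. rotate_fun ?n c g \<in> ?P}"
      then show "h \<in> ?P" by (elim imageE CollectE conjE) (intro CollectI conjI, simp_all only:)
    qed
    have "inj_on (rotate_fun ?n c) {g \<in> ?G. rotate_fun ?n c g \<in> ?P}"
      using bij_betw_imp_inj_on[OF b] by (rule inj_on_subset) blast
    from card_image[OF this] show ?thesis by (simp only: image)
  qed
  \<comment> \<open>each function on the circle is counted once, for its unique parking rotation\<close>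
  have "(?n + 1) ^ ?n = (\<Sum>g\<in>?G. card {c \<in> {0..?n}. rotate_fun ?n c g \<in> ?P})"
    using unique card_functions_nat_le[of ?n, where 'n = 'n] by simp
  also have "\<dots> = (\<Sum>c\<in>{0..?n}. card {g \<in> ?G. rotate_fun ?n c g \<in> ?P})"
    using sum.swap_restrict[OF finG, of "{0..?n}" "\<lambda>_ _. 1 :: nat" "\<lambda>g c. rotate_fun ?n c g \<in> ?P"]
    by (simp only: card_eq_sum finite_atLeastAtMost)
  also have "\<dots> = (?n + 1) * card ?P" using per_shift by simp
  finally have "(?n + 1) * card ?P = (?n + 1) * (?n + 1) ^ (?n - 1)"
    by (simp flip: power_Suc)
  then have "card ?P = (?n + 1) ^ (?n - 1)" by (subst (asm) mult_left_cancel) simp_all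
  moreover have "card (parking_functions :: ('n \<Rightarrow> nat) set) = card ?P"
    unfolding parking_functions_Suc by (subst card_image) (auto simp: inj_on_def fun_eq_iff)
  ultimately show ?thesis by simp
qed

section \<open>The isomorphism\<close>

lemma finite_parking_functions: "finite (parking_functions :: ('n::finite \<Rightarrow> nat) set)"
  by (rule card_ge_0_finite) (simp add: card_parking_functions)

text \<open>The pairing of the functionals with the normal words is triangular when parking functions are
  ordered by this number.\<close>

definition energy :: "('n::finite \<Rightarrow> nat) \<Rightarrow> int" where
  "energy b = (\<Sum>p\<in>UNIV. (int CARD('n) - int (b p))\<^sup>2)"

lemma word_value_normal_self:
  assumes "b \<in> parking_functions"
  shows "word_value b (normal_word b) = 1"
proof -
  have pos: "b p \<ge> 1" for p using assms by (simp add: parking_functions_def image_subset_iff)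
  have "coef (normal_word b) (\<lambda>p. int CARD('a) - 1 - int (b p - 1)) = 1"
  proof (rule coef_leading)
    fix s assume "s < length (normal_word b)"
    then show "int CARD('a) - 1 - int (b (fst (normal_word b ! s)) - 1)
        = snd (normal_word b ! s) + int (length (normal_word b) - Suc s)"
      using pos[of "colour_order b ! s"] by (simp add: normal_word_def of_nat_diff)
  qed (simp add: map_fst_normal_word distinct_colour_order)
  then show ?thesis
    by (simp add: word_value_def map_fst_normal_word distinct_colour_order)
       (simp add: normal_word_def)
qed

text \<open>Let \<open>a = n - b\<close> and \<open>a' = n - b'\<close>. The exponents \<open>a\<close> decrease along the normal word of \<open>b\<close>, so
  the dominance inequality with weight \<open>a\<close> says \<open>\<Sum>\<^sub>p a p (a' p - a p) \<ge> 0\<close>. The claim follows from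
  \<open>\<Sum>\<^sub>p (a' p)\<^sup>2 = \<Sum>\<^sub>p (a p)\<^sup>2 + 2 \<Sum>\<^sub>p a p (a' p - a p) + \<Sum>\<^sub>p (a' p - a p)\<^sup>2\<close>.\<close>

lemma word_value_normal_triangular:
  fixes b b' :: "'n::finite \<Rightarrow> nat"
  assumes b: "b \<in> parking_functions" and b': "b' \<in> parking_functions"
    and nz: "word_value b' (normal_word b) \<noteq> 0" and ne: "b' \<noteq> b"
  shows "energy b < energy b'"
proof -
  let ?n = "CARD('n)"
  define a where "a p = int ?n - int (b p)" for p
  define a' where "a' p = int ?n - 1 - int (b' p - 1)" for p
  have pos: "b p \<ge> 1" "b' p \<ge> 1" for p
    using b b' by (simp_all add: parking_functions_def image_subset_iff)
  have a'_eq: "a' p = int ?n - int (b' p)" for p using pos[of p] by (simp add: a'_def of_nat_diff)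
  have len: "length (normal_word b) = ?n" by (simp add: normal_word_def)
  have "0 \<le> (\<Sum>s<length (normal_word b). a (fst (normal_word b ! s)) *
      (a' (fst (normal_word b ! s)) - snd (normal_word b ! s) - int (length (normal_word b) - Suc s)))"
  proof (rule coef_dominance)
    show "coef (normal_word b) a' \<noteq> 0"
      using nz unfolding word_value_def a'_def by (metis (full_types))
    show "distinct (map fst (normal_word b))"
      by (simp add: map_fst_normal_word distinct_colour_order)
    show "sorted_wrt (\<lambda>x y. a (fst y) \<le> a (fst x)) (normal_word b)"
      using colour_order_mono[of _ _ b]
      by (auto simp: sorted_wrt_iff_nth_less normal_word_def a_def)
  qed
  also have "\<dots> = (\<Sum>s<?n. (\<lambda>p. a p * (a' p - a p)) (colour_order b ! s))"
    unfolding len by (intro sum.cong refl) (simp add: normal_word_def a_def of_nat_diff)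
  also have "\<dots> = (\<Sum>p\<in>UNIV. a p * (a' p - a p))"
    by (rule sum.reindex_bij_betw)
      (use bij_betw_nth[OF distinct_colour_order refl set_colour_order[symmetric], of b] in
        \<open>simp add: length_colour_order\<close>)
  finally have cross: "0 \<le> (\<Sum>p\<in>UNIV. a p * (a' p - a p))" .
  obtain p where "b' p \<noteq> b p" using ne by (auto simp: fun_eq_iff)
  then have "a' p - a p \<noteq> 0" by (simp add: a_def a'_eq)
  then have "0 < (\<Sum>p\<in>UNIV. (a' p - a p)\<^sup>2)"
    by (intro sum_pos2[of _ p]) auto
  moreover have "energy b' = energy b + 2 * (\<Sum>p\<in>UNIV. a p * (a' p - a p)) + (\<Sum>p\<in>UNIV. (a' p - a p)\<^sup>2)"
    unfolding energy_def sum_distrib_left sum.distrib[symmetric]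
    by (intro sum.cong refl) (simp add: a_def a'_eq power2_eq_square algebra_simps)
  ultimately show ?thesis using cross by linarith
qed

lemma multi_word_iff_count:
  fixes ws :: "('n::finite \<times> int) list"
  shows "multi_word ws \<longleftrightarrow> length ws = CARD('n) \<and> (\<forall>(p, i)\<in>set ws. i \<ge> 0)
      \<and> (\<forall>p. count_list (map fst ws) p = 1)"
proof -
  have count_distinct: "distinct xs \<Longrightarrow> p \<in> set xs \<Longrightarrow> count_list xs p = 1" for xs :: "'n list" and p
    by (induction xs) auto
  have "distinct (map fst ws) \<longleftrightarrow> (\<forall>p. count_list (map fst ws) p = 1)" if "length ws = CARD('n)"
  proof
    assume d: "distinct (map fst ws)"
    then have "set (map fst ws) = UNIV"
      using that by (intro card_subset_eq) (simp_all add: distinct_card[of "map fst ws"] del: set_map)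
    with d show "\<forall>p. count_list (map fst ws) p = 1"
      using count_distinct by blast
  next
    assume *: "\<forall>p. count_list (map fst ws) p = 1"
    have "set (map fst ws) = UNIV"
    proof (intro set_eqI iffI UNIV_I)
      fix p show "p \<in> set (map fst ws)" using * count_notin[of p "map fst ws"] by force
    qed
    then show "distinct (map fst ws)" using that by (intro card_distinct) simp
  qed
  then show ?thesis unfolding multi_word_def by auto
qed

lemma Q_multi_eq_span_normal:
  "(Q_multi :: 'n::finite fock set) = fock.span (monomial ` normal_word ` parking_functions)"
proof -
  have Q: "(Q_multi :: 'n fock set) = fock.span (monomial ` {ws. multi_word ws})"
    unfolding Q_multi_def multi_word_iff_count by (rule arg_cong[of _ _ fock.span]) blast
  show ?thesis unfolding Q
  proof (rule fock.span_eq[THEN iffD2], intro conjI)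
    show "monomial ` {ws. multi_word ws} \<subseteq> fock.span (monomial ` normal_word ` (parking_functions :: ('n \<Rightarrow> nat) set))"
      by (auto intro: monomial_in_span_normal)
    show "monomial ` normal_word ` (parking_functions :: ('n \<Rightarrow> nat) set) \<subseteq> fock.span (monomial ` {ws. multi_word ws})"
      by (auto intro!: fock.span_base imageI multi_word_normal_word)
  qed
qed

definition to_PF :: "'n::finite fock \<Rightarrow> (('n \<Rightarrow> nat) \<Rightarrow>\<^sub>0 complex)" where
  "to_PF x = (\<Sum>b\<in>parking_functions. Poly_Mapping.single b (fock_value b x))"

lemma lookup_to_PF:
  "Poly_Mapping.lookup (to_PF x) b = (if b \<in> parking_functions then fock_value b x else 0)"
  by (simp add: to_PF_def lookup_sum lookup_single when_def sum.delta finite_parking_functions)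

lemma to_PF_linear:
  "to_PF (x + y) = to_PF x + to_PF y"
  "to_PF (scale_fock c x) = scale_pm c (to_PF x)"
  by (rule poly_mapping_eqI; simp add: lookup_to_PF lookup_add fock_value_linear)+

interpretation to_PF: Vector_Spaces.linear scale_fock scale_pm to_PF
  by unfold_locales (simp_all add: to_PF_linear)

lemma to_PF_mem_PF: "to_PF x \<in> PF"
proof -
  have "Poly_Mapping.single b c \<in> PF" if "b \<in> parking_functions" for b :: "'a \<Rightarrow> nat" and c
    using pm.span_scale[OF pm.span_base[OF imageI[OF that]], of c pt] unfolding PF_def by simp
  then show ?thesis unfolding to_PF_def PF_def by (intro pm.span_sum) simp
qed

text \<open>Back substitution in the unitriangular system, starting with the smallest energy. This gives
  injectivity of \<open>to_PF\<close> as well as independence of the normal monomials.\<close>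

lemma normal_combination_eq_0:
  fixes c :: "('n::finite \<Rightarrow> nat) \<Rightarrow> complex"
  assumes "to_PF (\<Sum>b\<in>parking_functions. scale_fock (c b) (monomial (normal_word b))) = 0"
    and "b \<in> parking_functions"
  shows "c b = 0"
  using assms(2)
proof (induction "nat (energy b)" arbitrary: b rule: less_induct)
  case less
  have energy_nonneg: "energy b \<ge> 0" for b :: "'n \<Rightarrow> nat" unfolding energy_def by (simp add: sum_nonneg)
  let ?M = "\<lambda>b'. word_value b (normal_word b')"
  interpret f: Vector_Spaces.linear scale_fock "(*) :: complex \<Rightarrow> _" "fock_value b"
    by unfold_locales (simp_all add: fock_value_linear distrib_left distrib_right)
  have zero: "c b' * ?M b' = 0" if "b' \<in> parking_functions - {b}" for b'
  proof (cases "?M b' = 0")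
    case False
    then have "energy b' < energy b" using word_value_normal_triangular[of b' b] that less.prems by auto
    then have "nat (energy b') < nat (energy b)" using energy_nonneg[of b'] by simp
    with less.hyps that show ?thesis by simp
  qed simp
  have rest: "(\<Sum>b'\<in>parking_functions - {b}. c b' * ?M b') = 0"
    using zero by (intro sum.neutral ballI)
  have "0 = Poly_Mapping.lookup (to_PF (\<Sum>b\<in>parking_functions. scale_fock (c b) (monomial (normal_word b)))) b"
    by (simp only: assms(1) lookup_zero)
  also have "\<dots> = (\<Sum>b'\<in>parking_functions. c b' * ?M b')"
    using less.prems by (simp add: lookup_to_PF f.sum f.scale fock_value_monomial)
  also have "\<dots> = c b * ?M b"
    using less.prems rest
    by (subst sum.remove[of _ b]) (simp_all only: finite_parking_functions add_0_right)
  finally show ?case using word_value_normal_self[OF less.prems] by simp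
qed

lemma Q_multi_combination:
  assumes "x \<in> (Q_multi :: 'n::finite fock set)"
  obtains c where "x = (\<Sum>b\<in>parking_functions. scale_fock (c b) (monomial (normal_word b)))"
proof -
  have "x \<in> fock.span ((\<lambda>b. monomial (normal_word b)) ` parking_functions)"
    using assms unfolding Q_multi_eq_span_normal image_image .
  then have "\<exists>c. x = (\<Sum>b\<in>parking_functions. scale_fock (c b) (monomial (normal_word b)))"
  proof (induction rule: fock.span_induct_alt)
    case base
    show ?case by (intro exI[of _ "\<lambda>_. 0"]) simp
  next
    case (step d y z)
    then obtain b0 c where b0: "b0 \<in> parking_functions" "y = monomial (normal_word b0)"
      and z: "z = (\<Sum>b\<in>parking_functions. scale_fock (c b) (monomial (normal_word b)))" by blast
    have "scale_fock d y + z = (\<Sum>b\<in>parking_functions. scale_fock (c b + (if b = b0 then d else 0)) (monomial (normal_word b)))"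
      using b0 by (simp add: z fock.scale_left_distrib sum.distrib if_distrib[of "\<lambda>e. scale_fock e _"]
          sum.delta finite_parking_functions add.commute cong: if_cong)
    then show ?case by (rule exI[where x = "\<lambda>b. c b + (if b = b0 then d else 0)"])
  qed
  then show thesis using that by blast
qed

lemma inj_on_to_PF: "inj_on to_PF (Q_multi :: 'n::finite fock set)"
proof (rule inj_onI)
  fix x y :: "'n fock" assume xy: "x \<in> Q_multi" "y \<in> Q_multi" "to_PF x = to_PF y"
  then have "x - y \<in> Q_multi" unfolding Q_multi_def by (intro fock.span_diff)
  then obtain c where c: "x - y = (\<Sum>b\<in>parking_functions. scale_fock (c b) (monomial (normal_word b)))"
    by (rule Q_multi_combination)
  moreover have "to_PF (x - y) = 0" using xy(3) by (simp add: to_PF.diff)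
  ultimately have "\<forall>b\<in>parking_functions. c b = 0" using normal_combination_eq_0[of c] by simp
  with c have "x - y = 0" by simp
  then show "x = y" by simp
qed

text \<open>The same system solved from the largest energy downwards: the image of a normal monomial is
  the basis vector of its parking function plus basis vectors of larger energy.\<close>

lemma pt_mem_to_PF_image:
  fixes b :: "'n::finite \<Rightarrow> nat"
  assumes "b \<in> parking_functions"
  shows "pt b \<in> to_PF ` Q_multi"
  using assms
proof (induction "nat (Max (energy ` (parking_functions :: ('n \<Rightarrow> nat) set)) - energy b)" arbitrary: b rule: less_induct)
  case less
  let ?P = "parking_functions :: ('n \<Rightarrow> nat) set"
  let ?x = "monomial (normal_word b)"
  have image: "to_PF ` Q_multi = pm.span (to_PF ` monomial ` normal_word ` ?P)"
    unfolding Q_multi_eq_span_normal by (rule to_PF.span_image[symmetric])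
  have x: "to_PF ?x \<in> to_PF ` Q_multi"
    unfolding image using less.prems by (intro pm.span_base imageI)
  have rest: "Poly_Mapping.single b' (word_value b' (normal_word b)) \<in> to_PF ` Q_multi" if b': "b' \<in> ?P - {b}" for b'
  proof (cases "word_value b' (normal_word b) = 0")
    case True
    then show ?thesis unfolding image by (simp add: pm.span_zero)
  next
    case False
    then have "energy b < energy b'"
      using word_value_normal_triangular[of b b'] less.prems b' by auto
    moreover have "energy b' \<le> Max (energy ` ?P)"
      using b' by (intro Max_ge) (auto simp: finite_parking_functions)
    ultimately have "pt b' \<in> to_PF ` Q_multi" using b' by (intro less.hyps) auto
    then have "scale_pm (word_value b' (normal_word b)) (pt b') \<in> to_PF ` Q_multi"
      unfolding image by (rule pm.span_scale)
    then show ?thesis by simp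
  qed
  have "to_PF ?x = pt b + (\<Sum>b'\<in>?P - {b}. Poly_Mapping.single b' (word_value b' (normal_word b)))"
    unfolding to_PF_def fock_value_monomial using less.prems
    by (subst sum.remove[of _ b]) (simp_all add: finite_parking_functions word_value_normal_self)
  then have "pt b = to_PF ?x - (\<Sum>b'\<in>?P - {b}. Poly_Mapping.single b' (word_value b' (normal_word b)))"
    by simp
  also have "\<dots> \<in> to_PF ` Q_multi"
    using x rest unfolding image by (intro pm.span_diff pm.span_sum)
  finally show ?case .
qed

lemma bij_betw_to_PF: "bij_betw to_PF (Q_multi :: 'n::finite fock set) PF"
  unfolding bij_betw_def
proof (intro conjI inj_on_to_PF subset_antisym)
  show "to_PF ` Q_multi \<subseteq> (PF :: (('n \<Rightarrow> nat) \<Rightarrow>\<^sub>0 complex) set)" using to_PF_mem_PF by blast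
  have image: "to_PF ` (Q_multi :: 'n fock set) = pm.span (to_PF ` monomial ` normal_word ` parking_functions)"
    unfolding Q_multi_eq_span_normal by (rule to_PF.span_image[symmetric])
  show "(PF :: (('n \<Rightarrow> nat) \<Rightarrow>\<^sub>0 complex) set) \<subseteq> to_PF ` Q_multi"
    unfolding PF_def
  proof (rule pm.span_minimal)
    show "pt ` parking_functions \<subseteq> to_PF ` (Q_multi :: 'n fock set)" using pt_mem_to_PF_image by blast
    show "pm.subspace (to_PF ` (Q_multi :: 'n fock set))" unfolding image by (rule pm.subspace_span)
  qed
qed

lemma inj_on_monomial_normal:
  "inj_on (\<lambda>b :: 'n::finite \<Rightarrow> nat. monomial (normal_word b)) parking_functions"
proof (rule inj_onI, rule ccontr)
  fix b b' :: "'n \<Rightarrow> nat"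
  assume P: "b \<in> parking_functions" "b' \<in> parking_functions"
    and eq: "monomial (normal_word b) = monomial (normal_word b')" and ne: "b \<noteq> b'"
  have "word_value c (normal_word b) = word_value c (normal_word b')" for c
    using arg_cong[OF eq, of "fock_value c"] by (simp only: fock_value_monomial)
  then have "word_value b (normal_word b') = 1" "word_value b' (normal_word b) = 1"
    using word_value_normal_self P by metis+
  then have "energy b' < energy b" "energy b < energy b'"
    using word_value_normal_triangular P ne by (metis zero_neq_one)+
  then show False by simp
qed

lemma dim_Q_multi:
  "fock.dim (Q_multi :: 'n::finite fock set) = card (parking_functions :: ('n \<Rightarrow> nat) set)"
proof -
  let ?m = "\<lambda>b :: 'n \<Rightarrow> nat. monomial (normal_word b)"
  have "fock.independent (?m ` parking_functions)"
  proof (rule fock.independent_if_scalars_zero)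
    fix f x assume sum: "(\<Sum>x\<in>?m ` parking_functions. scale_fock (f x) x) = 0" and x: "x \<in> ?m ` parking_functions"
    from sum have "(\<Sum>b\<in>parking_functions. scale_fock (f (?m b)) (?m b)) = 0"
      by (simp add: sum.reindex[OF inj_on_monomial_normal])
    then have "to_PF (\<Sum>b\<in>parking_functions. scale_fock (f (?m b)) (?m b)) = 0" by simp
    then show "f x = 0" using normal_combination_eq_0[of "\<lambda>b. f (?m b)"] x by blast
  qed (simp add: finite_parking_functions)
  then have "fock.dim (fock.span (?m ` parking_functions)) = card (?m ` parking_functions)"
    by (rule fock.dim_span_eq_card_independent)
  then show ?thesis
    unfolding Q_multi_eq_span_normal image_image by (simp add: card_image[OF inj_on_monomial_normal])
qed

lemma parking_functions_comp_inv:
  fixes \<sigma> :: "'n::finite \<Rightarrow> 'n"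
  assumes "bij \<sigma>"
  shows "bij_betw (\<lambda>b. b \<circ> inv \<sigma>) parking_functions parking_functions"
proof -
  have closed: "b \<circ> \<tau> \<in> parking_functions" if "b \<in> parking_functions" "bij \<tau>" for b and \<tau> :: "'n \<Rightarrow> 'n"
  proof -
    have "card ((b \<circ> \<tau>) -` A) = card (b -` A)" for A
      using that(2) card_vimage_inj[of \<tau> "b -` A"] by (simp add: vimage_comp bij_is_inj bij_is_surj)
    then show ?thesis using that(1) by (auto simp: parking_functions_def)
  qed
  show ?thesis
  proof (rule bij_betw_byWitness[where f' = "\<lambda>b. b \<circ> \<sigma>"])
    show "\<forall>b\<in>parking_functions. b \<circ> inv \<sigma> \<circ> \<sigma> = b" "\<forall>b\<in>parking_functions. b \<circ> \<sigma> \<circ> inv \<sigma> = b"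
      using assms by (simp_all add: o_assoc[symmetric] bij_is_inj surj_iff[THEN iffD1, OF bij_is_surj])
  qed (use closed assms bij_imp_bij_inv in auto)
qed

lemma fock_value_recolour:
  fixes \<sigma> :: "'n::finite \<Rightarrow> 'n"
  assumes "bij \<sigma>" "x \<in> Q_multi"
  shows "fock_value (b \<circ> inv \<sigma>) (recolour \<sigma> x) = fock_value b x"
  using assms(2) unfolding Q_multi_def
proof (induction rule: fock.span_induct_alt)
  case base
  have zero: "fock_value c 0 = 0" for c :: "'n \<Rightarrow> nat" using fock_value_linear(2)[of c 0 0] by simp
  have "recolour \<sigma> 0 = 0" using recolour_linear(2)[of \<sigma> 0 0] by simp
  then show ?case by (simp add: zero)
next
  case (step c y z)
  then obtain ws where "y = monomial ws" by blast
  with step.IH show ?case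
    by (simp only: recolour_linear fock_value_linear recolour_monomial fock_value_monomial
        word_value_recolour[OF assms(1)])
qed

text \<open>Permuting the colours carries the functional of \<open>b\<close> to that of \<open>b \<circ> inv \<sigma>\<close>, and
  \<open>b \<mapsto> b \<circ> inv \<sigma>\<close> is the action on parking functions.\<close>

lemma to_PF_recolour:
  fixes \<sigma> :: "'n::finite \<Rightarrow> 'n"
  assumes "bij \<sigma>" "x \<in> Q_multi"
  shows "to_PF (recolour \<sigma> x) = PF_act \<sigma> (to_PF x)"
proof -
  interpret push: Vector_Spaces.linear scale_pm scale_pm "push_pm (\<lambda>b :: 'n \<Rightarrow> nat. b \<circ> inv \<sigma>)"
    by (rule push_pm_linear)
  have "to_PF (recolour \<sigma> x)
      = (\<Sum>b\<in>parking_functions. Poly_Mapping.single (b \<circ> inv \<sigma>) (fock_value (b \<circ> inv \<sigma>) (recolour \<sigma> x)))"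
    unfolding to_PF_def
    by (rule sum.reindex_bij_betw[symmetric, OF parking_functions_comp_inv[OF assms(1)],
          where g = "\<lambda>b. Poly_Mapping.single b (fock_value b (recolour \<sigma> x))"])
  also have "\<dots> = PF_act \<sigma> (to_PF x)"
    unfolding PF_act_def to_PF_def push.sum by (simp add: fock_value_recolour[OF assms])
  finally show ?thesis .
qed

theorem theorem1:
  shows "fock.dim (Q_multi :: 'n::finite fock set) = card (parking_functions :: ('n \<Rightarrow> nat) set)
    \<and> fock.dim (Q_multi :: 'n fock set) = (CARD('n) + 1) ^ (CARD('n) - 1)
    \<and> rep_isomorphic {\<sigma> :: 'n \<Rightarrow> 'n. bij \<sigma>}
         scale_fock (Q_multi :: 'n fock set) recolour
         scale_pm (PF :: (('n \<Rightarrow> nat) \<Rightarrow>\<^sub>0 complex) set) PF_act"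
proof (intro conjI)
  show "rep_isomorphic {\<sigma> :: 'n \<Rightarrow> 'n. bij \<sigma>} scale_fock (Q_multi :: 'n fock set) recolour
         scale_pm (PF :: (('n \<Rightarrow> nat) \<Rightarrow>\<^sub>0 complex) set) PF_act"
    unfolding rep_isomorphic_def
    by (intro exI[of _ to_PF] conjI ballI allI bij_betw_to_PF)
      (auto simp: to_PF_linear to_PF_recolour)
qed (simp_all only: dim_Q_multi card_parking_functions)

end
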